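(* Let $\gamma\in\mathbb C$, $t,a,b,c\in\mathbb C\setminus\{0\}$ with $|t|<1$, $x=\cos\theta\in[-1,1]$, and parameters generic so that no denominator vanishes (in particular $t/a\notin\{q^m:m\in\mathbb Z\}$, $ab,ac,tb,tc\notin\Omega_q$). Then $$\sum_{n=0}^\infty\frac{(\gamma;q)_n\,p_n(x;a,b,c|q)}{(q,ab,ac;q)_n}t^n=\frac{(ae^{\pm i\theta};q)_\infty}{(ab,ac;q)_\infty}\left(\frac{(ab,ac,\gamma t/a;q)_\infty}{(ae^{\pm i\theta},t/a;q)_\infty}{}_4\phi_3\!\left(\begin{matrix}\gamma,ae^{\pm i\theta},0\\ ab,ac,qa/t\end{matrix};q,q\right)+\frac{(tb,tc,\gamma;q)_\infty}{(te^{\pm i\theta},a/t;q)_\infty}{}_4\phi_3\!\left(\begin{matrix}\gamma t/a,te^{\pm i\theta},0\\ tb,tc,qt/a\end{matrix};q,q\right)\right).$$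
   Context: $q\in\mathbb C$, $0<|q|<1$; $(a;q)_n=\prod_{j=0}^{n-1}(1-aq^j)$, $(a;q)_\infty=\prod_{j\ge0}(1-aq^j)$, several entries mean a product; $e^{\pm i\theta}$ as an entry means both $e^{i\theta},e^{-i\theta}$. $\Omega_q=\{q^{-k}:k\in\mathbb N_0\}$. ${}_4\phi_3\!\left(\begin{smallmatrix}a_1,\dots,a_4\\ b_1,b_2,b_3\end{smallmatrix};q,z\right)=\sum_{k\ge0}\frac{(a_1,\dots,a_4;q)_k}{(q,b_1,b_2,b_3;q)_k}z^k$. Continuous dual $q$-Hahn polynomials: for $x=\cos\theta$, $p_n(x;a,b,c|q)=a^{-n}(ab,ac;q)_n\sum_{k=0}^n\frac{(q^{-n},ae^{i\theta},ae^{-i\theta};q)_k}{(q,ab,ac;q)_k}q^k$. *)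

theory Defs
  imports "HOL-Analysis.Analysis"
begin

definition qpoch :: "complex \<Rightarrow> complex \<Rightarrow> nat \<Rightarrow> complex" where
  "qpoch a q n = (\<Prod>j<n. 1 - a * q ^ j)"

definition qpoch_inf :: "complex \<Rightarrow> complex \<Rightarrow> complex" where
  "qpoch_inf a q = (\<Prod>j. 1 - a * q ^ j)"

definition Omega_q :: "complex \<Rightarrow> complex set" where
  "Omega_q q = {w. \<exists>k::nat. w = inverse (q ^ k)}"

definition phi43 :: "complex \<Rightarrow> complex \<Rightarrow> complex \<Rightarrow> complex \<Rightarrow> complex \<Rightarrow> complex \<Rightarrow> complex
    \<Rightarrow> complex \<Rightarrow> complex \<Rightarrow> complex" where
  "phi43 a1 a2 a3 a4 b1 b2 b3 q z =
     (\<Sum>k. (qpoch a1 q k * qpoch a2 q k * qpoch a3 q k * qpoch a4 q k)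
          / (qpoch q q k * qpoch b1 q k * qpoch b2 q k * qpoch b3 q k) * z ^ k)"

definition cdqH :: "nat \<Rightarrow> real \<Rightarrow> complex \<Rightarrow> complex \<Rightarrow> complex \<Rightarrow> complex \<Rightarrow> complex" where
  "cdqH n \<theta> a b c q =
     inverse (a ^ n) * qpoch (a*b) q n * qpoch (a*c) q n *
     (\<Sum>k=0..n. (qpoch (inverse (q ^ n)) q k * qpoch (a * cis \<theta>) q k * qpoch (a * cis (-\<theta>)) q k)
        / (qpoch q q k * qpoch (a*b) q k * qpoch (a*c) q k) * q ^ k)"

end

theory Submission
  imports Defs "HOL-Complex_Analysis.Complex_Analysis"
begin

text \<open>
  Put $d = e^{i\theta}$, $e = e^{-i\theta}$. For a function $g$ let \<open>v g n\<close> be the sum defining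
  $p_n$ with $1/(ab,ac;q)_k$ replaced by $g(aq^k)$, and let \<open>J g t\<close> be the right-hand side
  for $\gamma = 0$, a Jackson-type integral of $g$ over the orbits $aq^k$ and $tq^k$; the
  theorem concerns $g(z) = (bz,cz;q)_\infty$. Both $\sum_n v(g,n)t^n$ and $J(g,t)$ turn
  multiplication of $g$ by $z$ into the same operation $a\,T_q + t$, with $T_q$ the dilation
  $t \mapsto qt$. For $g = 1$ both satisfy a first-order $q$-difference equation in $t$ and tend to
  $1$ along $tq^N$, so they agree; hence they agree for monomials and, by absolute convergence,
  for entire $g$. For general $\gamma$ both sides are entire in $\gamma$ and satisfy
  $D(\gamma,t) = (1-\gamma)D(q\gamma,t) + \gamma D(\gamma,qt)$, which together with the case $\gamma = 0$
  determines all power series coefficients in $\gamma$.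
\<close>

subsection \<open>Series and power series\<close>

text \<open>Letting g vary keeps every equation in t first order: b and c never enter a q-difference
  equation, they are seen only through the Taylor coefficients of g. Since a is arbitrary, those
  coefficients have to be summable at radius |a| + |t|, whence the demand that g be entire. An
  equation is solved for g = 1 only; the operator for multiplication by z gives one relation between
  the integrals of 1 and z, and a telescoping sum or a summation by parts gives the second. The
  factor (\<gamma>;q)_n depends on n and not on z, so it does not act through g. Instead
  (1-\<gamma>)(q\<gamma>;q)_n = (1-\<gamma>q^n)(\<gamma>;q)_n trades q^n for the dilation of t. For
  the coefficient c_m(t) of \<gamma>^m in the difference of the two sides this yields (1-q^m) c_m(t)
  = c_{m-1}(qt) - q^{m-1} c_{m-1}(t). The values at t thus involve those at qt, so the statements
  are proved for a set of points t that is stable under t -> qt.\<close>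

lemma sums_swap:
  fixes f :: "nat \<Rightarrow> nat \<Rightarrow> 'a::banach"
  assumes "\<And>m. summable (\<lambda>n. norm (f m n))"
    and "summable (\<lambda>m. \<Sum>n. norm (f m n))"
  shows "(\<lambda>n. \<Sum>m. f m n) sums (\<Sum>m. \<Sum>n. f m n)"
    and "summable (\<lambda>n. norm (\<Sum>m. f m n))"
    and "summable (\<lambda>m. norm (f m n))"
proof -
  have inner: "(\<Sum>\<^sub>\<infinity>n. norm (f m n)) = (\<Sum>n. norm (f m n))" for m
    using norm_summable_imp_has_sum[of "\<lambda>n. norm (f m n)"] assms(1)
    by (intro infsumI) auto
  \<comment> \<open>Unordered sums over pairs make the two orders of summation symmetric; absolute
    convergence leads back to ordered series.\<close>
  have "(\<lambda>p. norm (case p of (m, n) \<Rightarrow> f m n)) summable_on UNIV \<times> UNIV"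
    unfolding Infinite_Sum.abs_summable_on_Sigma_iff
  proof (intro conjI ballI)
    show "(\<lambda>n. norm (case (m, n) of (m, n) \<Rightarrow> f m n)) summable_on UNIV" for m
      using assms(1)[of m] norm_summable_imp_summable_on[of "\<lambda>n. norm (f m n)"] by simp
    show "(\<lambda>m. norm (\<Sum>\<^sub>\<infinity>n. norm (case (m, n) of (m, n) \<Rightarrow> f m n))) summable_on UNIV"
      using assms norm_summable_imp_summable_on[of "\<lambda>m. \<Sum>n. norm (f m n)"]
      by (simp add: inner suminf_nonneg)
  qed
  then have abs: "(\<lambda>p. norm (case p of (n, m) \<Rightarrow> f m n)) summable_on UNIV \<times> UNIV"
    using summable_on_swap[of "\<lambda>(m,n). norm (f m n)" UNIV UNIV] 
    by (simp add: case_prod_unfold)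
  then have abs': "(\<lambda>m. norm (f m n)) summable_on UNIV" 
     "(\<lambda>n. norm (\<Sum>\<^sub>\<infinity>m. norm (f m n))) summable_on UNIV" for n
    unfolding Infinite_Sum.abs_summable_on_Sigma_iff by auto
  have on: "(\<lambda>(n, m). f m n) summable_on UNIV \<times> UNIV"
    using abs by (rule abs_summable_summable)
  show sm: "summable (\<lambda>m. norm (f m n))" for n
    using abs'(1)[of n] summable_on_imp_summable by blast
  have in1: "(\<Sum>\<^sub>\<infinity>m. f m n) = (\<Sum>m. f m n)" for n
    using norm_summable_imp_has_sum[OF sm summable_sums[OF summable_norm_cancel[OF sm]]]
    by (rule infsumI)
  have in2: "(\<Sum>\<^sub>\<infinity>n. f m n) = (\<Sum>n. f m n)" for m
    using norm_summable_imp_has_sum[OF assms(1) summable_sums[OF summable_norm_cancel[OF assms(1)]]]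
    by (rule infsumI)
  have in3: "(\<Sum>\<^sub>\<infinity>m. norm (f m n)) = (\<Sum>m. norm (f m n))" for n
    using norm_summable_imp_has_sum[of "\<lambda>m. norm (f m n)"] sm[of n]
    by (intro infsumI) auto
  have "summable (\<lambda>n. norm (\<Sum>m. norm (f m n)))"
    using abs'(2) summable_on_imp_summable unfolding in3 by blast
  then show "summable (\<lambda>n. norm (\<Sum>m. f m n))"
    by (rule summable_comparison_test') (simp add: summable_norm sm order_trans[OF summable_norm abs_ge_self])
  have s3: "summable (\<lambda>m. norm (\<Sum>n. f m n))"
    by (rule summable_comparison_test'[OF assms(2)]) (simp add: summable_norm assms(1))
  have in4: "(\<Sum>\<^sub>\<infinity>m. \<Sum>n. f m n) = (\<Sum>m. \<Sum>n. f m n)"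
    using norm_summable_imp_has_sum[OF s3 summable_sums[OF summable_norm_cancel[OF s3]]]
    by (rule infsumI)
  have "((\<lambda>n. \<Sum>\<^sub>\<infinity>m. f m n) has_sum (\<Sum>\<^sub>\<infinity>n. \<Sum>\<^sub>\<infinity>m. f m n)) UNIV"
    using summable_on_Sigma_banach[OF on] by (rule has_sum_infsum)
  also have "(\<Sum>\<^sub>\<infinity>n. \<Sum>\<^sub>\<infinity>m. f m n) = (\<Sum>\<^sub>\<infinity>m. \<Sum>\<^sub>\<infinity>n. f m n)"
    using infsum_swap_banach[OF on] .
  finally show "(\<lambda>n. \<Sum>m. f m n) sums (\<Sum>m. \<Sum>n. f m n)"
    unfolding in1 in2 in4 by (rule has_sum_imp_sums)
qed

lemma summable_norm_convergent_times_power: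
  fixes X :: "nat \<Rightarrow> complex"
  assumes "convergent X" and "norm z < 1"
  shows "summable (\<lambda>k. norm (X k * z ^ k))"
proof -
  obtain K where "\<And>k. norm (X k) \<le> K"
    using convergent_imp_Bseq[OF assms(1)] unfolding Bseq_def by blast
  then have "norm (norm (X k * z ^ k)) \<le> K * norm z ^ k" for k
    by (simp add: norm_mult norm_power mult_right_mono)
  moreover have "summable (\<lambda>k. K * norm z ^ k)"
    by (rule summable_mult[OF summable_geometric]) (simp add: assms(2))
  ultimately show ?thesis
    using summable_comparison_test'[of "\<lambda>k. K * norm z ^ k" 0 "\<lambda>k. norm (X k * z ^ k)"] by blast
qed

lemma norm_mult_lt_1: "norm x < 1 \<Longrightarrow> norm y \<le> 1 \<Longrightarrow> norm (x * y :: complex) < 1"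
  using mult_left_mono[of "norm y" 1 "norm x"] by (simp add: norm_mult)

text \<open>Eventually all factors are below some c < 1 in norm, so the partial products, read as
  the terms of a series, pass the ratio test.\<close>

lemma prod_tendsto_0:
  fixes f :: "nat \<Rightarrow> complex"
  assumes "f \<longlonglongrightarrow> l" and "norm l < 1"
  shows "(\<lambda>N. \<Prod>i<N. f i) \<longlonglongrightarrow> 0"
proof -
  obtain c where c: "norm l < c" "c < 1"
    using assms(2) dense by blast
  have "eventually (\<lambda>n. norm (f n) < c) sequentially"
    using order_tendstoD(2)[OF tendsto_norm[OF assms(1)] c(1)] .
  then obtain M where M: "\<And>n. n \<ge> M \<Longrightarrow> norm (f n) < c"
    by (auto simp: eventually_sequentially)
  have "summable (\<lambda>N. \<Prod>i<N. f i)"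
  proof (rule summable_ratio_test[OF c(2)])
    fix n assume "n \<ge> M"
    from less_imp_le[OF M[OF this]]
    show "norm (\<Prod>i<Suc n. f i) \<le> c * norm (\<Prod>i<n. f i)"
      by (simp add: norm_mult mult.commute mult_right_mono)
  qed
  then show ?thesis
    by (rule summable_LIMSEQ_zero)
qed

lemma fps_nth_mult_one_minus_X:
  "(F * (1 - fps_const c * fps_X)) $ n = F $ n - c * (if n = 0 then 0 else F $ (n - 1) :: complex)"
proof -
  have "F * (1 - fps_const c * fps_X) = F - fps_const c * (fps_X * F)"
    by (simp add: algebra_simps)
  then show ?thesis by simp
qed

lemma powser_eq_0:
  fixes c :: "nat \<Rightarrow> complex"
  assumes "\<And>z. (\<lambda>m. c m * z ^ m) sums 0"
  shows "c m = 0"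
proof -
  have "(\<lambda>_. 0) has_fps_expansion Abs_fps c"
    by (rule has_fps_expansionI) (simp add: assms)
  from fps_expansion_unique_complex[OF this has_fps_expansion_0] show ?thesis
    by (simp add: fps_eq_iff)
qed

lemma entire_power_series:
  assumes "g holomorphic_on UNIV"
  obtains c :: "nat \<Rightarrow> complex" where "\<And>z. (\<lambda>m. c m * z ^ m) sums g z"
    and "\<And>R. R \<ge> 0 \<Longrightarrow> summable (\<lambda>m. norm (c m) * R ^ m)"
proof
  let ?c = "\<lambda>m. (deriv ^^ m) g 0 / fact m"
  show sums: "(\<lambda>m. ?c m * z ^ m) sums g z" for z
    using holomorphic_power_series[of g 0 "norm z + 1" z] holomorphic_on_subset[OF assms] by simp
  \<comment> \<open>Convergence at R + 1 gives absolute convergence at the smaller radius R.\<close>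
  show "summable (\<lambda>m. norm (?c m) * R ^ m)" if "R \<ge> 0" for R
    using powser_insidea[OF sums_summable[OF sums[of "of_real (R + 1)"]], of "of_real R"] that
    by (simp add: norm_mult norm_divide norm_power)
qed

lemma power_series_sums_swap:
  fixes c w x :: "nat \<Rightarrow> complex"
  assumes "\<And>z. (\<lambda>m. c m * z ^ m) sums g z"
    and "summable (\<lambda>m. norm (c m) * R ^ m)"
    and "summable (\<lambda>k. norm (w k))" and "\<And>k. norm (x k) \<le> R"
  shows "(\<lambda>m. c m * (\<Sum>k. w k * x k ^ m)) sums (\<Sum>k. w k * g (x k))"
proof -
  define M where "M = (\<Sum>m. norm (c m) * R ^ m)"
  define f where "f k m = w k * (c m * x k ^ m)" for k m
  have le: "norm (c m * x k ^ m) \<le> norm (c m) * R ^ m" for k m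
    using assms(4)[of k] by (simp add: norm_mult norm_power mult_left_mono power_mono)
  have sx: "summable (\<lambda>m. norm (c m * x k ^ m))" for k
    using summable_comparison_test'[OF assms(2), of 0 "\<lambda>m. norm (c m * x k ^ m)"] le by simp
  have sf: "summable (\<lambda>m. norm (f k m))" for k
    unfolding f_def norm_mult[of "w k"] by (rule summable_mult[OF sx])
  have "(\<Sum>m. norm (f k m)) \<le> norm (w k) * M" for k
    unfolding f_def norm_mult[of "w k"] suminf_mult[OF sx] M_def
    by (intro mult_left_mono suminf_le le sx assms(2)) simp
  then have sum_sf: "summable (\<lambda>k. \<Sum>m. norm (f k m))"
    using summable_comparison_test'[OF summable_mult2[OF assms(3), of M], of 0 "\<lambda>k. \<Sum>m. norm (f k m)"]
      suminf_nonneg[OF sf] by simp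
  have "(\<Sum>m. f k m) = w k * g (x k)" for k
    unfolding f_def using sums_unique[OF sums_mult[OF assms(1)]] by metis
  moreover have "(\<Sum>k. f k m) = c m * (\<Sum>k. w k * x k ^ m)" for m
  \<comment> \<open>Summability of \<open>w k * x k ^ m\<close> comes from the double series by
    dividing by \<open>c m\<close>; when \<open>c m\<close> is zero both sides vanish
    anyway.\<close>
  proof (cases "c m = 0")
    case True
    then show ?thesis by (simp add: f_def)
  next
    case False
    have "summable (\<lambda>k. f k m)"
      using sums_swap(3)[OF sf sum_sf] by (rule summable_norm_cancel)
    from summable_mult[OF this, of "1 / c m"] False have "summable (\<lambda>k. w k * x k ^ m)"
      by (simp add: f_def)
    from suminf_mult[OF this, of "c m"] show ?thesis
      by (simp add: f_def mult.left_commute)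
  qed
  ultimately show ?thesis
    using sums_swap(1)[OF sf sum_sf] by simp
qed

subsection \<open>$q$-shifted factorials\<close>

lemma qpoch_0 [simp]: "qpoch x q 0 = 1"
  and qpoch_Suc: "qpoch x q (Suc n) = qpoch x q n * (1 - x * q ^ n)"
  by (simp_all add: qpoch_def)

lemma qpoch_zero [simp]: "qpoch 0 q n = 1"
  by (simp add: qpoch_def)

lemma qpoch_Suc_left: "qpoch x q (Suc n) = (1 - x) * qpoch (q * x) q n"
proof -
  have "qpoch x q (Suc n) = (1 - x) * (\<Prod>j<n. 1 - x * (q * q ^ j))"
    unfolding qpoch_def prod.lessThan_Suc_shift by simp
  then show ?thesis
    unfolding qpoch_def by (simp add: ac_simps)
qed

text \<open>Both sides are (x;q)_{n+1}, with the first or the last factor split off. This identity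
  is behind the shifts in t, in \<gamma> and of q^{-n}.\<close>

lemma qpoch_shift: "(1 - x) * qpoch (q * x) q n = qpoch x q n * (1 - x * q ^ n)"
  using qpoch_Suc_left[of x q n] qpoch_Suc[of x q n] by simp

lemma qpoch_eq_0_iff: "qpoch x q n = 0 \<longleftrightarrow> (\<exists>j<n. x * q ^ j = 1)"
  unfolding qpoch_def by auto

lemma not_Omega_q_iff:
  assumes "q \<noteq> 0"
  shows "x \<notin> Omega_q q \<longleftrightarrow> (\<forall>j. x * q ^ j \<noteq> 1)"
  using assms unfolding Omega_q_def by (auto simp: field_simps)

section \<open>Infinite products for |q| < 1 and entire dependence on a parameter\<close>

locale nome =
  fixes q :: complex
  assumes q_nonzero [simp]: "q \<noteq> 0" and norm_q: "norm q < 1"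
begin

text \<open>Follows from 1 + x \<le> exp x and the geometric series. The bound is free of n, so it
  can serve as a dominating constant.\<close>

lemma prod_one_plus_geometric_le:
  assumes "R \<ge> 0"
  shows "(\<Prod>j<n. 1 + R * norm q ^ j) \<le> exp (R / (1 - norm q))"
proof -
  have "(\<Prod>j<n. 1 + R * norm q ^ j) \<le> (\<Prod>j<n. exp (R * norm q ^ j))"
    using assms by (intro prod_mono) (auto intro: add_nonneg_nonneg)
  also have "\<dots> = exp (R * (\<Sum>j<n. norm q ^ j))"
    by (simp add: exp_sum sum_distrib_left)
  also have "(\<Sum>j<n. norm q ^ j) \<le> (\<Sum>j. norm q ^ j)"
    using norm_q by (intro sum_le_suminf summable_geometric) auto
  also have "(\<Sum>j. norm q ^ j) = 1 / (1 - norm q)"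
    using norm_q by (intro suminf_geometric) auto
  finally show ?thesis using assms by (simp add: mult_left_mono)
qed

lemma norm_qpoch_le: "norm (qpoch x q n) \<le> exp (norm x / (1 - norm q))"
proof -
  have "norm (qpoch x q n) \<le> (\<Prod>j<n. 1 + norm x * norm q ^ j)"
    unfolding qpoch_def prod_norm[symmetric]
    by (intro prod_mono) (metis norm_ge_zero norm_mult norm_one norm_power norm_triangle_ineq4)
  also have "\<dots> \<le> exp (norm x / (1 - norm q))"
    by (rule prod_one_plus_geometric_le) simp
  finally show ?thesis .
qed

lemma convergent_prod_qpoch: "convergent_prod (\<lambda>j. 1 - x * q ^ j)"
proof (rule abs_convergent_prod_imp_convergent_prod)
  show "abs_convergent_prod (\<lambda>j. 1 - x * q ^ j)"
    unfolding abs_convergent_prod_conv_summable using norm_q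
    by (simp add: norm_mult norm_power summable_mult summable_geometric)
qed

lemma qpoch_tendsto: "(\<lambda>n. qpoch x q n) \<longlonglongrightarrow> qpoch_inf x q"
proof -
  have "(\<lambda>n. \<Prod>j\<le>n. 1 - x * q ^ j) \<longlonglongrightarrow> (\<Prod>j. 1 - x * q ^ j)"
    using convergent_prod_LIMSEQ[OF convergent_prod_qpoch] .
  then show ?thesis
    unfolding qpoch_def qpoch_inf_def
    by (subst LIMSEQ_lessThan_iff_atMost) simp
qed

lemma qpoch_inf_eq_0_iff: "qpoch_inf x q = 0 \<longleftrightarrow> (\<exists>j. x * q ^ j = 1)"
  using has_prod_eq_0_iff[OF convergent_prod_has_prod[OF convergent_prod_qpoch[of x]]]
  unfolding qpoch_inf_def by (auto simp: image_iff)

lemma qpoch_inf_nonzero: "norm x < 1 \<Longrightarrow> qpoch_inf x q \<noteq> 0"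
proof
  assume x: "norm x < 1" and "qpoch_inf x q = 0"
  then obtain j where "x * q ^ j = 1" unfolding qpoch_inf_eq_0_iff by blast
  then have "norm x * norm q ^ j = 1" by (metis norm_mult norm_one norm_power)
  moreover have "norm x * norm q ^ j \<le> norm x * 1"
    using norm_q by (intro mult_left_mono power_le_one) auto
  ultimately show False using x by simp
qed

lemma qpoch_nonzero: "norm x < 1 \<Longrightarrow> qpoch x q n \<noteq> 0"
  using qpoch_inf_nonzero[of x] unfolding qpoch_inf_eq_0_iff qpoch_eq_0_iff by blast

lemma qpoch_inf_split: "qpoch_inf x q = qpoch x q n * qpoch_inf (x * q ^ n) q"
proof -
  have "(\<lambda>m. qpoch x q (m + n)) = (\<lambda>m. qpoch x q n * qpoch (x * q ^ n) q m)"
  proof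
    show "qpoch x q (m + n) = qpoch x q n * qpoch (x * q ^ n) q m" for m
      by (induction m) (auto simp: qpoch_Suc power_add mult_ac)
  qed
  then have "(\<lambda>m. qpoch x q (m + n)) \<longlonglongrightarrow> qpoch x q n * qpoch_inf (x * q ^ n) q"
    using qpoch_tendsto by (simp add: tendsto_mult)
  then show ?thesis
    using LIMSEQ_ignore_initial_segment[OF qpoch_tendsto] LIMSEQ_unique by blast
qed

lemma qpoch_inf_shift: "qpoch_inf x q = (1 - x) * qpoch_inf (q * x) q"
  using qpoch_inf_split[of x 1] by (simp add: qpoch_Suc mult.commute)

text \<open>The partial sums are polynomials in x and converge uniformly on each closed ball of
  radius 1, where \<open>norm_qpoch_le\<close> bounds all factors by one constant. The scale s
  covers both (\<gamma>;q)_n and (\<gamma>t/a;q)_n.\<close>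

lemma entire_qpoch_series:
  assumes "summable (\<lambda>n. norm (u n))"
  shows "(\<lambda>x. \<Sum>n. qpoch (x * s) q n * u n) holomorphic_on UNIV"
proof -
  define f where "f N x = (\<Sum>n<N. qpoch (x * s) q n * u n)" for N x
  define g where "g x = (\<Sum>n. qpoch (x * s) q n * u n)" for x
  have hol: "f N holomorphic_on UNIV" for N
    unfolding f_def qpoch_def by (intro holomorphic_intros)
  have unif: "uniform_limit (cball x0 1) f g sequentially" for x0
    unfolding f_def g_def
  proof (rule Weierstrass_m_test)
    define M where "M = exp ((norm x0 + 1) * norm s / (1 - norm q))"
    show "summable (\<lambda>n. M * norm (u n))"
      using assms by (rule summable_mult)
    fix n x assume "x \<in> cball x0 1"
    then have "norm x \<le> norm x0 + 1"
      using norm_triangle_sub[of x x0] by (simp add: dist_norm norm_minus_commute)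
    then have "norm (x * s) / (1 - norm q) \<le> (norm x0 + 1) * norm s / (1 - norm q)"
      using norm_q by (intro divide_right_mono) (auto simp: norm_mult mult_right_mono)
    then have "norm (qpoch (x * s) q n) \<le> M"
      unfolding M_def by (intro order_trans[OF norm_qpoch_le]) simp
    then show "norm (qpoch (x * s) q n * u n) \<le> M * norm (u n)"
      by (simp add: norm_mult mult_right_mono)
  qed
  have "g holomorphic_on UNIV"
  proof (rule holomorphic_uniform_sequence[of UNIV f])
    show "\<exists>d>0. cball x d \<subseteq> UNIV \<and> uniform_limit (cball x d) f g sequentially" for x
      using unif[of x] zero_less_one[where 'a = real] by blast
  qed (simp_all add: hol)
  then show ?thesis
    by (simp add: g_def[abs_def])
qed

lemma entire_qpoch_inf: "(\<lambda>x. qpoch_inf (x * s) q) holomorphic_on UNIV"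
proof -
  \<comment> \<open>Since (x;q)_n - (x;q)_{n+1} = x q^n (x;q)_n, telescoping turns the infinite
    product into a series of the kind already known to be entire.\<close>
  have eq: "qpoch_inf x q = 1 - x * (\<Sum>n. qpoch x q n * q ^ n)" for x
  proof -
    have "(\<lambda>n. qpoch x q n - qpoch x q (Suc n)) sums (qpoch x q 0 - qpoch_inf x q)"
      by (rule telescope_sums'[OF qpoch_tendsto])
    also have "(\<lambda>n. qpoch x q n - qpoch x q (Suc n)) = (\<lambda>n. x * (qpoch x q n * q ^ n))"
      by (simp add: qpoch_Suc algebra_simps)
    finally have 1: "(\<lambda>n. x * (qpoch x q n * q ^ n)) sums (1 - qpoch_inf x q)"
      by simp
    have 2: "summable (\<lambda>n. qpoch x q n * q ^ n)"
      using summable_norm_convergent_times_power[OF convergentI[OF qpoch_tendsto] norm_q]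
      by (rule summable_norm_cancel)
    have "x * (\<Sum>n. qpoch x q n * q ^ n) = 1 - qpoch_inf x q"
      unfolding suminf_mult[OF 2, symmetric] using 1 by (rule sums_unique[symmetric])
    then show ?thesis by (simp add: algebra_simps)
  qed
  have "(\<lambda>x. \<Sum>n. qpoch (x * s) q n * q ^ n) holomorphic_on UNIV"
    by (rule entire_qpoch_series) (simp add: norm_power norm_q summable_geometric)
  then show ?thesis
    unfolding eq
    by (rule holomorphic_on_diff[OF holomorphic_on_const holomorphic_on_mult[OF
      holomorphic_on_mult[OF holomorphic_on_ident holomorphic_on_const]]])
qed

end

subsection \<open>The Jackson-type integral\<close>

locale q_integral = nome +
  fixes a d e :: complex
  assumes a_nonzero [simp]: "a \<noteq> 0" and norm_d: "norm d \<le> 1" and norm_e: "norm e \<le> 1"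
begin

text \<open>The weight of the point x q^k when y is the other base point; the two orbit sums use (x,
  y) = (a, t) and (x, y) = (t, a).\<close>

definition W :: "complex \<Rightarrow> complex \<Rightarrow> nat \<Rightarrow> complex" where
  "W x y k = qpoch (x * d) q k * qpoch (x * e) q k / (qpoch q q k * qpoch (q * x / y) q k)"

lemma qpoch_q_nonzero [simp]: "qpoch q q k \<noteq> 0"
  using qpoch_nonzero[OF norm_q] .

lemma qpoch_inf_q_nonzero [simp]: "qpoch_inf q q \<noteq> 0"
  using qpoch_inf_nonzero[OF norm_q] .

lemma qpoch_inf_quotient_nonzero:
  assumes "y \<noteq> 0" and "\<And>k. x * q ^ Suc k \<noteq> y"
  shows "qpoch_inf (q * x / y) q \<noteq> 0"
  unfolding qpoch_inf_eq_0_iff using assms by (auto simp: field_simps)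

lemma qpoch_quotient_nonzero:
  assumes "y \<noteq> 0" and "\<And>k. x * q ^ Suc k \<noteq> y"
  shows "qpoch (q * x / y) q k \<noteq> 0"
  unfolding qpoch_eq_0_iff using assms by (auto simp: field_simps)

lemma W_tendsto:
  assumes "y \<noteq> 0" and "\<And>k. x * q ^ Suc k \<noteq> y"
  shows "W x y \<longlonglongrightarrow> qpoch_inf (x * d) q * qpoch_inf (x * e) q / (qpoch_inf q q * qpoch_inf (q * x / y) q)"
  unfolding W_def[abs_def] using qpoch_inf_quotient_nonzero[OF assms]
  by (intro tendsto_divide tendsto_mult qpoch_tendsto) simp

lemma q_power_tendsto_0: "(\<lambda>k. q ^ k) \<longlonglongrightarrow> 0"
  using norm_q by (rule LIMSEQ_power_zero)

lemma summable_W: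
  assumes "y \<noteq> 0" and "\<And>k. x * q ^ Suc k \<noteq> y" and "convergent f"
  shows "summable (\<lambda>k. norm (W x y k * q ^ k * f k))"
proof -
  have "convergent (\<lambda>k. W x y k * f k)"
    using convergentI[OF W_tendsto[OF assms(1,2)]] assms(3) by (rule convergent_mult)
  from summable_norm_convergent_times_power[OF this norm_q] show ?thesis
    by (simp add: mult_ac)
qed

text \<open>
  With $z = xq^k$, consecutive weights have ratio $\frac{(1-dz)(1-ez)}{(1-qz/x)(1-qz/y)}$, so the differences of
  $W_k(1-z/x)(1-z/y)$ are $W_k\,[(1-dz)(1-ez) - (1-z/x)(1-z/y)]$, and the bracket is divisible by $z$.
\<close>

lemma W_telescope:
  assumes "y \<noteq> 0" and "\<And>k. x * q ^ Suc k \<noteq> y"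
  shows "(\<lambda>k. W x y k * q ^ k * (x * q ^ k * (1 - x * y * d * e) - (x + y - x * y * (d + e)))) sums
     (- y * (qpoch_inf (x * d) q * qpoch_inf (x * e) q / (qpoch_inf q q * qpoch_inf (q * x / y) q)))"
proof -
  \<comment> \<open>The factor -y clears the denominators 1/x and 1/y once z = x q^k is inserted.
    Since 1 - q^0 = 0, \<open>S 0\<close> vanishes and only the limit of S remains.\<close>
  define S where "S k = - y * (W x y k * ((1 - q ^ k) * (1 - x / y * q ^ k)))" for k
  define L where "L = qpoch_inf (x * d) q * qpoch_inf (x * e) q / (qpoch_inf q q * qpoch_inf (q * x / y) q)"
  have "S \<longlonglongrightarrow> - y * (L * ((1 - 0) * (1 - x / y * 0)))"
    unfolding S_def[abs_def] L_def
    by (intro tendsto_mult tendsto_diff tendsto_const W_tendsto q_power_tendsto_0 assms)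
  then have "(\<lambda>k. S (Suc k) - S k) sums (- y * L - S 0)"
    by (intro telescope_sums) simp
  moreover have "S (Suc k) - S k = W x y k * q ^ k * (x * q ^ k * (1 - x * y * d * e) - (x + y - x * y * (d + e)))" for k
  proof -
    have nz: "1 - q * q ^ k \<noteq> 0" "1 - x / y * (q * q ^ k) \<noteq> 0"
      using qpoch_q_nonzero[of "Suc k"] qpoch_quotient_nonzero[OF assms, of "Suc k"]
      unfolding qpoch_Suc by (auto simp: mult_ac)
    have "W x y (Suc k) = W x y k * ((1 - x * d * q ^ k) * (1 - x * e * q ^ k)) / ((1 - q * q ^ k) * (1 - x / y * (q * q ^ k)))"
      unfolding W_def qpoch_Suc by (simp add: mult_ac)
    then have "W x y (Suc k) * ((1 - q * q ^ k) * (1 - x / y * (q * q ^ k))) = W x y k * ((1 - x * d * q ^ k) * (1 - x * e * q ^ k))"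
      using nz by simp
    then have S_Suc: "S (Suc k) = - y * (W x y k * ((1 - x * d * q ^ k) * (1 - x * e * q ^ k)))"
      unfolding S_def by simp
    show ?thesis
      unfolding S_Suc S_def[of k] using assms(1) by (simp add: field_simps)
  qed
  ultimately show ?thesis
    unfolding L_def[symmetric] by (simp add: S_def)
qed

text \<open>The exclusion of t/a from the integer powers of q is split so that each half matches one
  product: the first keeps (t/a;q)_\<infinity> nonzero, the second (a/t;q)_\<infinity>.\<close>

definition admissible :: "complex \<Rightarrow> bool" where
  "admissible t \<longleftrightarrow> t \<noteq> 0 \<and> norm t < 1 \<and> (\<forall>k. t * q ^ k \<noteq> a \<and> a * q ^ k \<noteq> t)"

lemma admissible_shift:
  assumes "admissible t"
  shows "admissible (q * t)"
proof -
  have "norm (q * t) < 1"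
    using assms norm_q mult_strict_mono'[of "norm q" 1 "norm t" 1]
    by (simp add: admissible_def norm_mult)
  moreover have "q * t * q ^ k \<noteq> a" for k
    using assms unfolding admissible_def by (metis mult.commute mult.left_commute power_Suc)
  moreover have "a * q ^ k \<noteq> q * t" for k
    using assms unfolding admissible_def
    by (cases k) (auto simp: mult.left_commute, metis mult.commute power_0 power_Suc mult_1_right)
  ultimately show ?thesis
    using assms by (simp add: admissible_def)
qed

lemma admissible_nonzero:
  assumes "admissible t"
  shows "t \<noteq> 0" "1 - a / t \<noteq> 0" "1 - t / a \<noteq> 0" "1 - t * d \<noteq> 0" "1 - t * e \<noteq> 0"
    "qpoch_inf (t / a) q \<noteq> 0" "qpoch_inf (a / t) q \<noteq> 0"
    "qpoch_inf (t * d) q \<noteq> 0" "qpoch_inf (t * e) q \<noteq> 0"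
    "\<And>k. t * q ^ Suc k \<noteq> a" "\<And>k. a * q ^ Suc k \<noteq> t"
proof -
  have *: "t * q ^ k \<noteq> a" "a * q ^ k \<noteq> t" "t \<noteq> 0" "norm t < 1" for k
    using assms by (auto simp: admissible_def)
  show "t \<noteq> 0" "t * q ^ Suc k \<noteq> a" "a * q ^ Suc k \<noteq> t" for k by fact+
  show "1 - a / t \<noteq> 0" "1 - t / a \<noteq> 0"
    using *(1,2)[of 0] *(3) by auto
  show "qpoch_inf (t / a) q \<noteq> 0" "qpoch_inf (a / t) q \<noteq> 0"
    unfolding qpoch_inf_eq_0_iff using * by (auto simp: field_simps)
  show d: "qpoch_inf (t * d) q \<noteq> 0" "qpoch_inf (t * e) q \<noteq> 0"
    by (intro qpoch_inf_nonzero norm_mult_lt_1 *(4) norm_d norm_e)+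
  show "1 - t * d \<noteq> 0" "1 - t * e \<noteq> 0"
    using d qpoch_inf_shift by (metis mult_zero_left)+
qed

section \<open>The weights on the two orbits and their change under t -> qt\<close>

definition weight_a :: "complex \<Rightarrow> nat \<Rightarrow> complex" where
  "weight_a t k = W a t k * q ^ k / qpoch_inf (t / a) q"

text \<open>The asymmetry with \<open>weight_a\<close> comes from multiplying the outer factor
  (ad,ae;q)_\<infinity> of the claimed formula into both terms: it cancels in the first and stays in
  the second.\<close>

definition weight_t :: "complex \<Rightarrow> nat \<Rightarrow> complex" where
  "weight_t t k = qpoch_inf (a * d) q * qpoch_inf (a * e) q
     / (qpoch_inf (t * d) q * qpoch_inf (t * e) q * qpoch_inf (a / t) q) * (W t a k * q ^ k)"

text \<open>Replacing t by qt removes 1 - t/a from (t/a;q)_\<infinity> and turns (qa/t;q)_k into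
  (a/t;q)_k. Since (1-t/a)/(1-a/t) = -t/a, the net effect is multiplication by (z-t)/a at z = a
  q^k.\<close>

lemma weight_a_shift:
  assumes "admissible t"
  shows "a * weight_a (q * t) k = (a * q ^ k - t) * weight_a t k"
proof -
  note nz = admissible_nonzero[OF assms]
  define X where "X = qpoch (a * d) q k * qpoch (a * e) q k * q ^ k / qpoch q q k"
  define D where "D = qpoch (q * a / t) q k"
  define P where "P = qpoch_inf (q * t / a) q"
  have "P \<noteq> 0" "D \<noteq> 0"
    using qpoch_inf_quotient_nonzero[OF a_nonzero nz(10)] qpoch_quotient_nonzero[OF nz(1) nz(11)]
    unfolding P_def D_def .
  have 1: "qpoch_inf (t / a) q = (1 - t / a) * P"
    unfolding P_def using qpoch_inf_shift[of "t / a"] by simp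
  have 2: "qpoch (a / t) q k * (1 - a / t * q ^ k) = (1 - a / t) * D"
    unfolding D_def using qpoch_shift[of "a / t" q k] by simp
  have 3: "1 - a / t * q ^ k \<noteq> 0"
    using assms by (auto simp: admissible_def field_simps)
  have 4: "qpoch (a / t) q k = (1 - a / t) * D / (1 - a / t * q ^ k)"
    using 2 3 by (simp add: field_simps)
  have "weight_a (q * t) k = X / (qpoch (a / t) q k * P)"
    unfolding weight_a_def W_def X_def P_def by simp
  moreover have "weight_a t k = X / (D * qpoch_inf (t / a) q)"
    unfolding weight_a_def W_def X_def D_def by simp
  moreover define u v w where "u = 1 - a / t" and "v = 1 - t / a" and "w = 1 - a / t * q ^ k"
  moreover have "a * q ^ k - t = a * w * v / u"
    using nz(1-3) unfolding u_def v_def w_def by (simp add: field_simps)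
  ultimately show ?thesis
    unfolding 1 4 using nz(2,3) 3 \<open>P \<noteq> 0\<close> \<open>D \<noteq> 0\<close> by (simp add: mult_ac)
qed

text \<open>The k-th point of the orbit of qt is the point k + 1 of the orbit of t, hence the
  shifted index. The multiplier is again (z-t)/a, now at z = t q^{k+1}.\<close>

lemma weight_t_shift:
  assumes "admissible t"
  shows "a * weight_t (q * t) k = t * (q ^ Suc k - 1) * weight_t t (Suc k)"
proof -
  note nz = admissible_nonzero[OF assms]
  define X where "X = qpoch (q * (t * d)) q k * qpoch (q * (t * e)) q k * q ^ k / (qpoch q q k * qpoch (q * (q * t / a)) q k)"
  define Pd where "Pd = qpoch_inf (q * (t * d)) q"
  define Pe where "Pe = qpoch_inf (q * (t * e)) q"
  define P where "P = qpoch_inf (a / t) q"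
  define A where "A = qpoch_inf (a * d) q * qpoch_inf (a * e) q"
  have Pd: "qpoch_inf (t * d) q = (1 - t * d) * Pd" and Pe: "qpoch_inf (t * e) q = (1 - t * e) * Pe"
    unfolding Pd_def Pe_def by (rule qpoch_inf_shift)+
  have "Pd \<noteq> 0" "Pe \<noteq> 0" "P \<noteq> 0"
    using nz(7-9) unfolding Pd Pe P_def by auto
  have P: "qpoch_inf (a / (q * t)) q = (1 - a / (q * t)) * P"
    unfolding P_def using qpoch_inf_shift[of "a / (q * t)"] by simp
  have n1: "1 - a / (q * t) \<noteq> 0" "1 - q * t / a \<noteq> 0"
    using admissible_nonzero(2,3)[OF admissible_shift[OF assms]] .
  have n2: "1 - q * q ^ k \<noteq> 0"
    using qpoch_q_nonzero[of "Suc k"] unfolding qpoch_Suc by auto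
  define u v w where "u = 1 - a / (q * t)" and "v = 1 - q * t / a" and "w = 1 - q * q ^ k"
  note uvw = u_def[symmetric] v_def[symmetric] w_def[symmetric]
  have nuvw: "u \<noteq> 0" "v \<noteq> 0" "w \<noteq> 0"
    using n1 n2 by (simp_all add: u_def v_def w_def)
  have "W t a (Suc k) * q ^ Suc k = X * q * ((1 - t * d) * (1 - t * e)) / (v * w)"
    unfolding W_def X_def qpoch_Suc_left[of "t * d"] qpoch_Suc_left[of "t * e"] qpoch_Suc_left[of "q * t / a"] qpoch_Suc[of q] uvw
    by (simp add: mult_ac)
  then have "weight_t t (Suc k) = A / (Pd * Pe * P) * (X * q / (v * w))"
    unfolding weight_t_def A_def[symmetric] Pd Pe P_def[symmetric]
    using nz(4,5) by simp
  moreover have "weight_t (q * t) k = A / (Pd * Pe * (u * P)) * X"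
    unfolding weight_t_def P uvw unfolding A_def Pd_def Pe_def W_def X_def by (simp add: mult_ac)
  moreover have "t * (q ^ Suc k - 1) = a * v * w / (q * u)"
    using nz(1) n1 unfolding u_def v_def w_def by (simp add: field_simps)
  ultimately show ?thesis
    using nuvw \<open>Pd \<noteq> 0\<close> \<open>Pe \<noteq> 0\<close> \<open>P \<noteq> 0\<close> by simp
qed

section \<open>The functional J and its q-difference equation\<close>

definition J :: "(complex \<Rightarrow> complex) \<Rightarrow> complex \<Rightarrow> complex" where
  "J g t = (\<Sum>k. weight_a t k * g (a * q ^ k)) + (\<Sum>k. weight_t t k * g (t * q ^ k))"

lemma convergent_along_powers:
  fixes g :: "complex \<Rightarrow> complex"
  assumes "isCont g 0"
  shows "convergent (\<lambda>k. g (x * q ^ k))"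
proof -
  have "(\<lambda>k. x * q ^ k) \<longlonglongrightarrow> x * 0"
    by (intro tendsto_mult tendsto_const q_power_tendsto_0)
  then show ?thesis
    using isCont_tendsto_compose[OF assms] by (auto intro: convergentI)
qed

lemma summable_weights:
  assumes "admissible t" and "convergent f"
  shows "summable (\<lambda>k. norm (weight_a t k * f k))" "summable (\<lambda>k. norm (weight_t t k * f k))"
proof -
  note nz = admissible_nonzero[OF assms(1)]
  show "summable (\<lambda>k. norm (weight_a t k * f k))"
    unfolding weight_a_def 
    using summable_divide[OF summable_W[OF nz(1,11) assms(2)], of "norm (qpoch_inf (t / a) q)"] 
    by (simp add: norm_mult norm_divide)
  show "summable (\<lambda>k. norm (weight_t t k * f k))"
    unfolding weight_t_def
    using summable_mult[OF summable_W[OF a_nonzero nz(10) assms(2)], of "norm (qpoch_inf (a * d) q * qpoch_inf (a * e) q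
     / (qpoch_inf (t * d) q * qpoch_inf (t * e) q * qpoch_inf (a / t) q))"]
    by (simp add: norm_mult norm_divide mult.assoc)
qed

lemma J_sums:
  assumes "admissible t" and "isCont g 0"
  shows "(\<lambda>k. weight_a t k * g (a * q ^ k)) sums (\<Sum>k. weight_a t k * g (a * q ^ k))"
    and "(\<lambda>k. weight_t t k * g (t * q ^ k)) sums (\<Sum>k. weight_t t k * g (t * q ^ k))"
  by (intro summable_sums summable_norm_cancel[OF summable_weights(1)] assms
        summable_norm_cancel[OF summable_weights(2)] convergent_along_powers)+

lemma J_add:
  assumes "admissible t" and "isCont f 0" and "isCont g 0"
  shows "J (\<lambda>z. f z + g z) t = J f t + J g t"
  using J_sums[OF assms(1,2)] J_sums[OF assms(1,3)] unfolding J_def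
  by (simp add: distrib_left suminf_add[symmetric] sums_iff)

lemma J_cmult:
  assumes "admissible t" and "isCont f 0"
  shows "J (\<lambda>z. c * f z) t = c * J f t"
  using J_sums[OF assms(1,2)] unfolding J_def
  by (simp add: distrib_left suminf_mult mult.left_commute sums_iff)

text \<open>Both orbits acquire the same multiplier (z-t)/a. It vanishes at z = t, which is exactly
  the point missing from the orbit of qt, so the index shift loses nothing.\<close>

lemma J_shift:
  assumes "admissible t" and "isCont g 0"
  shows "J g (q * t) = J (\<lambda>z. (z - t) / a * g z) t"
proof -
  let ?h = "\<lambda>z. (z - t) / a * g z"
  have 1: "weight_a (q * t) k = (a * q ^ k - t) / a * weight_a t k" for k
    using weight_a_shift[OF assms(1), of k] by (simp add: field_simps)
  have 2: "weight_t (q * t) k = (t * q ^ Suc k - t) / a * weight_t t (Suc k)" for k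
    using weight_t_shift[OF assms(1), of k] by (simp add: field_simps)
  have "isCont ?h 0"
    by (intro continuous_intros assms(2) a_nonzero)
  then have "summable (\<lambda>k. weight_t t k * ?h (t * q ^ k))"
    using sums_summable[OF J_sums(2)[OF assms(1)]] by blast
  then have "(\<Sum>k. weight_t t k * ?h (t * q ^ k)) = (\<Sum>k. weight_t t (Suc k) * ?h (t * q ^ Suc k))"
    using suminf_split_head by fastforce
  then show ?thesis
    unfolding J_def 1 2 by (simp add: mult_ac)
qed

text \<open>Write z = a (z-t)/a + t and read the first summand as a dilation of t.\<close>

lemma J_times:
  assumes "admissible t" and "isCont g 0"
  shows "J (\<lambda>z. z * g z) t = a * J g (q * t) + t * J g t"
proof -
  let ?h = "\<lambda>z. (z - t) / a * g z"
  have h: "isCont ?h 0"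
    by (intro continuous_intros assms(2) a_nonzero)
  have "J (\<lambda>z. a * ?h z + t * g z) t = J (\<lambda>z. a * ?h z) t + J (\<lambda>z. t * g z) t"
    by (intro J_add assms(1) continuous_mult continuous_const h assms(2))
  also have "\<dots> = a * J g (q * t) + t * J g t"
    unfolding J_shift[OF assms] J_cmult[OF assms(1) h] J_cmult[OF assms] ..
  also have "(\<lambda>z. a * ?h z + t * g z) = (\<lambda>z. z * g z)"
  proof
    show "a * ?h z + t * g z = z * g z" for z
      by (simp add: left_diff_distrib)
  qed
  finally show ?thesis .
qed

text \<open>The affine function h produced by \<open>W_telescope\<close> is symmetric in a and t, so
  both orbit sums of h telescope to boundary limits. These cancel because t/(1-t/a) + a/(1-a/t) = 0;
  the relative normalization of the two weights is tuned to this.\<close>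

lemma J_recurrence:
  assumes "admissible t"
  shows "(1 - a * t * d * e) * J (\<lambda>z. z) t = (a + t - a * t * (d + e)) * J (\<lambda>z. 1) t"
proof -
  note nz = admissible_nonzero[OF assms]
  define h where "h z = z * (1 - a * t * d * e) - (a + t - a * t * (d + e))" for z
  define A where "A = qpoch_inf (a * d) q * qpoch_inf (a * e) q / qpoch_inf q q"
  define Pa Pt where "Pa = qpoch_inf (q * a / t) q" and "Pt = qpoch_inf (q * t / a) q"
  have P: "qpoch_inf (a / t) q = (1 - a / t) * Pa" "qpoch_inf (t / a) q = (1 - t / a) * Pt"
    unfolding Pa_def Pt_def using qpoch_inf_shift[of "a / t"] qpoch_inf_shift[of "t / a"] by simp_all
  have "(\<lambda>k. W a t k * q ^ k * h (a * q ^ k) / qpoch_inf (t / a) q) sums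
      (- t * (A / Pa) / qpoch_inf (t / a) q)"
    using sums_divide[OF W_telescope[OF nz(1,11)], of "qpoch_inf (t / a) q"]
    unfolding h_def A_def Pa_def by simp
  then have 1: "(\<lambda>k. weight_a t k * h (a * q ^ k)) sums (- t * A / (Pa * Pt * (1 - t / a)))"
    unfolding weight_a_def P by (simp add: mult_ac)
  have "(\<lambda>k. qpoch_inf (a * d) q * qpoch_inf (a * e) q
     / (qpoch_inf (t * d) q * qpoch_inf (t * e) q * qpoch_inf (a / t) q) * (W t a k * q ^ k * h (t * q ^ k))) sums
    (qpoch_inf (a * d) q * qpoch_inf (a * e) q
     / (qpoch_inf (t * d) q * qpoch_inf (t * e) q * qpoch_inf (a / t) q) *
       (- a * (qpoch_inf (t * d) q * qpoch_inf (t * e) q / (qpoch_inf q q * qpoch_inf (q * t / a) q))))"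
    using sums_mult[OF W_telescope[OF a_nonzero nz(10)], of "qpoch_inf (a * d) q * qpoch_inf (a * e) q
     / (qpoch_inf (t * d) q * qpoch_inf (t * e) q * qpoch_inf (a / t) q)"] unfolding h_def
    by (simp add: mult.commute[of t a] add.commute[of t a])
  then have 2: "(\<lambda>k. weight_t t k * h (t * q ^ k)) sums (- a * A / (Pa * Pt * (1 - a / t)))"
    unfolding weight_t_def A_def Pt_def[symmetric] P using nz(8,9) by (simp add: mult_ac)
  have "- t * A / (Pa * Pt * (1 - t / a)) + - a * A / (Pa * Pt * (1 - a / t))
     = - (A / (Pa * Pt)) * (t / (1 - t / a) + a / (1 - a / t))"
    unfolding divide_inverse inverse_mult_distrib by (simp add: algebra_simps)
  also have "t / (1 - t / a) + a / (1 - a / t) = 0"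
    using nz(1-3) by (simp add: divide_simps) (simp add: algebra_simps)?
  finally have 3: "- t * A / (Pa * Pt * (1 - t / a)) + - a * A / (Pa * Pt * (1 - a / t)) = 0"
    by simp
  have "J h t = 0"
    unfolding J_def sums_unique[OF 1, symmetric] sums_unique[OF 2, symmetric] by (rule 3)
  moreover have "h = (\<lambda>z. (1 - a * t * d * e) * z + (- (a + t - a * t * (d + e))) * 1)"
    by (rule ext) (simp add: h_def algebra_simps)
  then have "J h t = J (\<lambda>z. (1 - a * t * d * e) * z + (- (a + t - a * t * (d + e))) * 1) t"
    by (rule arg_cong)
  moreover have "\<dots> = (1 - a * t * d * e) * J (\<lambda>z. z) t + (- (a + t - a * t * (d + e))) * J (\<lambda>z. 1) t"
    unfolding J_cmult[OF assms continuous_ident, symmetric] J_cmult[OF assms continuous_const, symmetric]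
    by (intro J_add assms continuous_intros)
  ultimately show ?thesis by (simp add: algebra_simps)
qed

text \<open>Eliminates the integral of z between \<open>J_times\<close> and
  \<open>J_recurrence\<close>. The result is the equation satisfied by (atde;q)_\<infinity> /
  (td,te;q)_\<infinity>.\<close>

lemma J_one_shift:
  assumes "admissible t"
  shows "(1 - a * t * d * e) * J (\<lambda>_. 1) (q * t) = (1 - t * d) * (1 - t * e) * J (\<lambda>_. 1) t"
proof -
  have "J (\<lambda>z. z) t = a * J (\<lambda>_. 1) (q * t) + t * J (\<lambda>_. 1) t"
    using J_times[OF assms, of "\<lambda>_. 1"] by simp
  with J_recurrence[OF assms]
  have "a * ((1 - a * t * d * e) * J (\<lambda>_. 1) (q * t)) = a * ((1 - t * d) * (1 - t * e) * J (\<lambda>_. 1) t)"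
    by (simp add: algebra_simps)
  then show ?thesis by simp
qed

lemma admissible_power: "admissible t \<Longrightarrow> admissible (t * q ^ N)"
proof (induction N)
  case (Suc N)
  then show ?case
    using admissible_shift[of "t * q ^ N"] by (simp add: mult_ac)
qed simp

lemma J_shift_power:
  assumes "admissible t" and "isCont g 0"
  shows "J g (t * q ^ N) = J (\<lambda>z. g z * (\<Prod>i<N. (z - t * q ^ i) / a)) t"
  using assms(2)
proof (induction N arbitrary: g)
  case (Suc N)
  have "isCont (\<lambda>z. (z - t * q ^ N) / a * g z) 0"
    by (intro continuous_intros Suc.prems a_nonzero)
  moreover have "J g (t * q ^ Suc N) = J (\<lambda>z. (z - t * q ^ N) / a * g z) (t * q ^ N)"
    using J_shift[OF admissible_power[OF assms(1)] Suc.prems, of N] by (simp add: mult_ac)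
  ultimately show ?case
    using Suc.IH by (simp add: mult_ac)
qed simp

text \<open>
  Shifting $t$ to $tq^N$ multiplies the integrand by $\prod_{i<N} (z - tq^i)/a$. As $N \to \infty$ only
  the mass at $z = a$ survives.
\<close>

lemma J_one_tendsto:
  assumes "admissible t"
  shows "(\<lambda>N. J (\<lambda>_. 1) (t * q ^ N)) \<longlonglongrightarrow> 1"
proof -
  define p where "p N z = (\<Prod>i<N. (z - t * q ^ i) / a)" for N z
  \<comment> \<open>The 2 serves both orbits. At z = a q^k a factor is at most 1 + |t/a| |q|^i. At z
    = t q^k the product vanishes for k < N, and for k \<ge> N > i a factor is at most |t/a| (|q|^k +
    |q|^i) \<le> 2 |t/a| |q|^i.\<close>
  define K where "K = exp (2 * norm (t / a) / (1 - norm q))"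
  have bound: "norm (p N z) \<le> K" if "\<And>i. i < N \<Longrightarrow> norm ((z - t * q ^ i) / a) \<le> 1 + 2 * norm (t / a) * norm q ^ i" for N z
  proof -
    have "norm (p N z) \<le> (\<Prod>i<N. 1 + 2 * norm (t / a) * norm q ^ i)"
      unfolding p_def prod_norm[symmetric] by (intro prod_mono) (use that in auto)
    also have "\<dots> \<le> K"
      unfolding K_def by (rule prod_one_plus_geometric_le) simp
    finally show ?thesis .
  qed
  have bound_a: "norm (p N (a * q ^ k)) \<le> K" for N k
  proof (rule bound)
    fix i
    have "norm ((a * q ^ k - t * q ^ i) / a) = norm (q ^ k - t / a * q ^ i)"
      by (simp add: field_simps)
    also have "\<dots> \<le> norm q ^ k + norm (t / a) * norm q ^ i"
      using norm_triangle_ineq4[of "q ^ k" "t / a * q ^ i"] by (simp add: norm_mult norm_divide norm_power)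
    also have "\<dots> \<le> 1 + 2 * norm (t / a) * norm q ^ i"
      using norm_q by (intro add_mono power_le_one mult_right_mono) auto
    finally show "norm ((a * q ^ k - t * q ^ i) / a) \<le> 1 + 2 * norm (t / a) * norm q ^ i" .
  qed
  have zero_t: "p N (t * q ^ k) = 0" if "k < N" for N k
    unfolding p_def using that by (intro prod_zero) auto
  have bound_t: "norm (p N (t * q ^ k)) \<le> K" for N k
  proof (cases "k < N")
    case True
    then show ?thesis by (simp add: zero_t K_def)
  next
    case False
    show ?thesis
    proof (rule bound)
      fix i assume "i < N"
      then have "norm q ^ k \<le> norm q ^ i"
        using False norm_q by (intro power_decreasing) auto
      then have "norm (q ^ k - q ^ i) \<le> 2 * norm q ^ i"
        using norm_triangle_ineq4[of "q ^ k" "q ^ i"] by (simp add: norm_power)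
      then have "norm (t / a) * norm (q ^ k - q ^ i) \<le> norm (t / a) * (2 * norm q ^ i)"
        by (rule mult_left_mono) simp
      moreover have "(t * q ^ k - t * q ^ i) / a = t / a * (q ^ k - q ^ i)"
        by (simp add: field_simps)
      then have "norm ((t * q ^ k - t * q ^ i) / a) = norm (t / a) * norm (q ^ k - q ^ i)"
        by (simp only: norm_mult)
      ultimately show "norm ((t * q ^ k - t * q ^ i) / a) \<le> 1 + 2 * norm (t / a) * norm q ^ i"
        by linarith
    qed
  qed
  have lim_t: "(\<lambda>N. p N (t * q ^ k)) \<longlonglongrightarrow> 0" for k
    by (rule tendsto_eventually) (use eventually_gt_at_top[of k] in eventually_elim, rule zero_t)
  have lim_a: "(\<lambda>N. p N (a * q ^ k)) \<longlonglongrightarrow> (if k = 0 then qpoch_inf (t / a) q else 0)" for k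
  proof (cases "k = 0")
    case True
    have "p N a = qpoch (t / a) q N" for N
      unfolding p_def qpoch_def by (intro prod.cong) (auto simp: field_simps)
    then show ?thesis
      using qpoch_tendsto True by simp
  next
    case False
    have "(\<lambda>i. (a * q ^ k - t * q ^ i) / a) \<longlonglongrightarrow> (a * q ^ k - t * 0) / a"
      by (intro tendsto_intros q_power_tendsto_0 a_nonzero)
    moreover have "norm ((a * q ^ k - t * 0) / a) < 1"
      using False norm_q by (simp add: norm_power power_less_one_iff)
    ultimately show ?thesis
      using False unfolding p_def by (simp add: prod_tendsto_0)
  qed
  have tannery: "(\<lambda>N. \<Sum>k. w k * p N (x k)) \<longlonglongrightarrow> (\<Sum>k. w k * l k)"
    if "summable (\<lambda>k. norm (w k))" "\<And>k. (\<lambda>N. p N (x k)) \<longlonglongrightarrow> l k" "\<And>N k. norm (p N (x k)) \<le> K" for w x l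
  proof -
    have "summable (\<lambda>k. norm (w k) * K)"
      using that(1) by (rule summable_mult2)
    moreover have "norm (w k * p N (x k)) \<le> norm (w k) * K" for k N
      using that(3) by (simp add: norm_mult mult_left_mono)
    moreover have "(\<lambda>N. w k * p N (x k)) \<longlonglongrightarrow> w k * l k" for k
      by (intro tendsto_intros that(2))
    ultimately show ?thesis
      using tannerys_theorem[of "\<lambda>k N. w k * p N (x k)" "\<lambda>k. w k * l k" sequentially "\<lambda>k. norm (w k) * K"]
      by (simp add: always_eventually)
  qed
  have sw: "summable (\<lambda>k. norm (weight_a t k))" "summable (\<lambda>k. norm (weight_t t k))"
    using summable_weights[OF assms, of "\<lambda>_. 1"] by (simp_all add: convergent_const)
  \<comment> \<open>As \<open>W a t 0\<close> is 1, the mass at z = a is 1/(t/a;q)_\<infinity>, and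
    the limit (t/a;q)_\<infinity> of the multipliers normalizes it to 1.\<close>
  have "(\<Sum>k. weight_a t k * (if k = 0 then qpoch_inf (t / a) q else 0)) = 1"
    using sums_unique[OF sums_If_finite_set[of "{0}" "\<lambda>k. weight_a t k * qpoch_inf (t / a) q"]]
      admissible_nonzero(6)[OF assms] by (simp add: if_distrib weight_a_def W_def cong: if_cong)
  then have "(\<lambda>N. \<Sum>k. weight_a t k * p N (a * q ^ k)) \<longlonglongrightarrow> 1"
    using tannery[of "weight_a t" "\<lambda>k. a * q ^ k", OF sw(1) lim_a bound_a] by simp
  moreover have "(\<lambda>N. \<Sum>k. weight_t t k * p N (t * q ^ k)) \<longlonglongrightarrow> 0"
    using tannery[of "weight_t t" "\<lambda>k. t * q ^ k", OF sw(2) lim_t bound_t] by simp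
  ultimately have "(\<lambda>N. J (p N) t) \<longlonglongrightarrow> 1 + 0"
    unfolding J_def by (rule tendsto_add)
  then show ?thesis
    using J_shift_power[OF assms, of "\<lambda>_. 1"] unfolding p_def[abs_def] by simp
qed

subsection \<open>The generating function for $\gamma = 0$\<close>

text \<open>
  For $g(z) = (bz,cz;q)_\infty$ this is $(ab,ac;q)_\infty\, p_n / (q,ab,ac;q)_n$.
\<close>

definition v :: "(complex \<Rightarrow> complex) \<Rightarrow> nat \<Rightarrow> complex" where
  "v g n = inverse (a ^ n) / qpoch q q n *
     (\<Sum>k\<le>n. qpoch (inverse (q ^ n)) q k * (qpoch (a * d) q k * qpoch (a * e) q k / qpoch q q k) * q ^ k * g (a * q ^ k))"

lemma qpoch_inverse_power_eq_0: "n < k \<Longrightarrow> qpoch (inverse (q ^ n)) q k = 0"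
  unfolding qpoch_eq_0_iff by (auto intro!: exI[of _ n])

lemma q_times_inverse_power: "q * inverse (q ^ Suc n) = inverse (q ^ n)"
  by simp

text \<open>This is \<open>qpoch_shift\<close> at x = q^{-n-1}, scaled by -q^{n+1}. It lets a factor
  z - a q^{n+1} at z = a q^k lower the degree from n + 1 to n.\<close>

lemma qpoch_inverse_power_shift:
  "(q ^ k - q ^ Suc n) * qpoch (inverse (q ^ Suc n)) q k = (1 - q ^ Suc n) * qpoch (inverse (q ^ n)) q k"
proof -
  let ?x = "inverse (q ^ Suc n)"
  have "(1 - ?x) * qpoch (inverse (q ^ n)) q k = qpoch ?x q k * (1 - ?x * q ^ k)"
    using qpoch_shift[of ?x q k] unfolding q_times_inverse_power .
  then have "- (q ^ Suc n) * ((1 - ?x) * qpoch (inverse (q ^ n)) q k) = - (q ^ Suc n) * (qpoch ?x q k * (1 - ?x * q ^ k))"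
    by (rule arg_cong)
  moreover have "- (q ^ Suc n) * (1 - ?x) = 1 - q ^ Suc n" "- (q ^ Suc n) * (1 - ?x * q ^ k) = q ^ k - q ^ Suc n"
    by (simp_all add: right_diff_distrib del: power_Suc) 
  ultimately show ?thesis
    by (metis mult.assoc mult.commute)
qed

lemma v_times_0: "v (\<lambda>z. z * g z) 0 = a * v g 0"
  by (simp add: v_def)

text \<open>After subtracting a q^{n+1} the integrand carries a (q^k - q^{n+1}), which turns
  (q^{-n-1};q)_k into (q^{-n};q)_k. The term k = n + 1 then vanishes, and the leftover a (1 -
  q^{n+1}) adjusts the normalization from index n + 1 to n.\<close>

lemma v_times_Suc: "v (\<lambda>z. z * g z) (Suc n) = a * q ^ Suc n * v g (Suc n) + v g n"
proof -
  define U where "U k = qpoch (a * d) q k * qpoch (a * e) q k / qpoch q q k" for k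
  define c where "c = inverse (a ^ Suc n) / qpoch q q (Suc n)"
  let ?x = "inverse (q ^ Suc n)"
  have nz: "1 - q ^ Suc n \<noteq> 0"
    using qpoch_q_nonzero[of "Suc n"] unfolding qpoch_Suc by simp
  have "v (\<lambda>z. z * g z) (Suc n) - a * q ^ Suc n * v g (Suc n)
     = c * ((\<Sum>k\<le>Suc n. qpoch ?x q k * U k * q ^ k * (a * q ^ k * g (a * q ^ k)))
         - a * q ^ Suc n * (\<Sum>k\<le>Suc n. qpoch ?x q k * U k * q ^ k * g (a * q ^ k)))"
    unfolding v_def c_def[symmetric] U_def[symmetric] right_diff_distrib by (simp only: mult_ac)
  also have "\<dots> = c * (\<Sum>k\<le>Suc n. a * ((q ^ k - q ^ Suc n) * qpoch ?x q k) * U k * q ^ k * g (a * q ^ k))"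
    unfolding sum_distrib_left[of "a * q ^ Suc n"] sum_subtractf[symmetric]
    by (intro arg_cong[where f = "(*) c"] sum.cong refl) (simp add: algebra_simps del: power_Suc)
  also have "\<dots> = c * (\<Sum>k\<le>Suc n. a * (1 - q ^ Suc n) * (qpoch (inverse (q ^ n)) q k * U k * q ^ k * g (a * q ^ k)))"
    unfolding qpoch_inverse_power_shift by (simp only: mult.assoc)
  also have "\<dots> = c * (a * (1 - q ^ Suc n)) * (\<Sum>k\<le>n. qpoch (inverse (q ^ n)) q k * U k * q ^ k * g (a * q ^ k))"
    unfolding sum_distrib_left[symmetric] sum.atMost_Suc by (simp add: qpoch_inverse_power_eq_0 mult.assoc del: power_Suc)
  also have "c * (a * (1 - q ^ Suc n)) = inverse (a ^ n) / qpoch q q n"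
    using nz unfolding c_def qpoch_Suc by simp
  finally show ?thesis
    unfolding v_def[of g n] U_def[symmetric] by (simp add: algebra_simps)
qed

lemma v_one_0: "v (\<lambda>_. 1) 0 = 1"
  by (simp add: v_def)

text \<open>Summation by parts, the finite counterpart of \<open>W_telescope\<close>: with z = a q^k
  the surviving bracket is 1 - (1-dz)(1-ez) = z (d + e - dez).\<close>

lemma v_one_Suc: "(1 - q ^ Suc n) * v (\<lambda>_. 1) (Suc n) = (d + e) * v (\<lambda>_. 1) n - d * e * v (\<lambda>z. z) n"
proof -
  define U where "U k = qpoch (a * d) q k * qpoch (a * e) q k / qpoch q q k" for k
  define Q where "Q k = qpoch (inverse (q ^ n)) q k" for k
  define c where "c = inverse (a ^ Suc n) / qpoch q q n"
  have nz: "1 - q ^ Suc k \<noteq> 0" for k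
    using qpoch_q_nonzero[of "Suc k"] unfolding qpoch_Suc by simp
  have U_Suc: "U (Suc k) * (1 - q ^ Suc k) = U k * ((1 - a * d * q ^ k) * (1 - a * e * q ^ k))" for k
    using nz[of k] unfolding U_def qpoch_Suc by simp
  \<comment> \<open>Writing the term as this difference is what permits the summation by parts: 1 -
    q^{k+1} is the denominator factor by which U at k + 1 exceeds U at k.\<close>
  have Q: "qpoch (inverse (q ^ Suc n)) q (Suc k) * q ^ Suc k = Q (Suc k) - (1 - q ^ Suc k) * Q k" for k
  proof -
    define x where "x = inverse (q ^ Suc n)"
    have 1: "qpoch x q (Suc k) = (1 - x) * Q k"
      unfolding qpoch_Suc_left x_def q_times_inverse_power Q_def ..
    have 2: "Q (Suc k) = Q k * (1 - x * q ^ Suc k)"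
      unfolding Q_def qpoch_Suc x_def by simp
    show ?thesis
      unfolding x_def[symmetric] 1 2 by (simp add: algebra_simps del: power_Suc)
  qed
  have ca: "c * a = inverse (a ^ n) / qpoch q q n"
    unfolding c_def by simp
  have cn: "inverse (a ^ Suc n) / qpoch q q (Suc n) * (1 - q ^ Suc n) = c"
    using nz[of n] unfolding c_def qpoch_Suc by simp
  have "(1 - q ^ Suc n) * v (\<lambda>_. 1) (Suc n) = c * (\<Sum>k\<le>Suc n. qpoch (inverse (q ^ Suc n)) q k * U k * q ^ k)"
    unfolding cn[symmetric] v_def U_def by (simp add: mult_ac)
  also have "(\<Sum>k\<le>Suc n. qpoch (inverse (q ^ Suc n)) q k * U k * q ^ k)
      = U 0 + (\<Sum>k\<le>n. U (Suc k) * (qpoch (inverse (q ^ Suc n)) q (Suc k) * q ^ Suc k))"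
    unfolding sum.atMost_Suc_shift by (simp add: mult_ac)
  also have "\<dots> = U 0 + (\<Sum>k\<le>n. U (Suc k) * Q (Suc k) - U (Suc k) * (1 - q ^ Suc k) * Q k)"
    unfolding Q by (intro arg_cong[where f = "(+) (U 0)"] sum.cong refl) (simp add: algebra_simps del: power_Suc)
  also have "\<dots> = (\<Sum>k\<le>Suc n. U k * Q k) - (\<Sum>k\<le>n. U (Suc k) * (1 - q ^ Suc k) * Q k)"
    unfolding sum_subtractf sum.atMost_Suc_shift by (simp add: Q_def)
  also have "\<dots> = (\<Sum>k\<le>n. U k * Q k) - (\<Sum>k\<le>n. U (Suc k) * (1 - q ^ Suc k) * Q k)"
    by (simp add: Q_def qpoch_inverse_power_eq_0)
  also have "\<dots> = (\<Sum>k\<le>n. a * (Q k * U k * q ^ k * ((d + e) - d * e * (a * q ^ k))))"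
    unfolding sum_subtractf[symmetric] U_Suc by (intro sum.cong refl) (simp add: algebra_simps)
  also have "c * \<dots> = (c * a) * (\<Sum>k\<le>n. Q k * U k * q ^ k * ((d + e) - d * e * (a * q ^ k)))"
    unfolding sum_distrib_left[symmetric] by simp
  also have "\<dots> = (d + e) * v (\<lambda>_. 1) n - d * e * v (\<lambda>z. z) n"
    unfolding v_def ca U_def[symmetric] Q_def[symmetric] sum_distrib_left sum_subtractf[symmetric]
    by (intro sum.cong refl) (simp add: algebra_simps add_divide_distrib)
  finally show ?thesis .
qed

section \<open>Convergence and q-difference equation of the generating function\<close>

definition Gen :: "(complex \<Rightarrow> complex) \<Rightarrow> complex \<Rightarrow> complex" where
  "Gen g t = (\<Sum>n. v g n * t ^ n)"

lemma summable_v_shift: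
  assumes "summable (\<lambda>n. norm (v g n * t ^ n))"
  shows "summable (\<lambda>n. norm (v g n * (q * t) ^ n))"
    and "(\<Sum>n. norm (v g n * (q * t) ^ n)) \<le> (\<Sum>n. norm (v g n * t ^ n))"
proof -
  have le: "norm (v g n * (q * t) ^ n) \<le> norm (v g n * t ^ n)" for n
  proof -
    have "norm q ^ n * norm t ^ n \<le> 1 * norm t ^ n"
      using norm_q by (intro mult_right_mono power_le_one) auto
    then show ?thesis
      by (simp add: norm_mult norm_power power_mult_distrib mult_left_mono)
  qed
  show s: "summable (\<lambda>n. norm (v g n * (q * t) ^ n))"
    using summable_comparison_test'[OF assms, of 0 "\<lambda>n. norm (v g n * (q * t) ^ n)"] le by simp
  show "(\<Sum>n. norm (v g n * (q * t) ^ n)) \<le> (\<Sum>n. norm (v g n * t ^ n))"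
    by (rule suminf_le[OF le s assms])
qed

lemma v_times_decomp:
  "v (\<lambda>z. z * g z) n * t ^ n = a * (v g n * (q * t) ^ n) + t * (case n of 0 \<Rightarrow> 0 | Suc m \<Rightarrow> v g m * t ^ m)"
proof (cases n)
  case 0
  then show ?thesis by (simp add: v_times_0)
next
  case (Suc m)
  then show ?thesis by (simp add: v_times_Suc power_mult_distrib distrib_right)
qed

text \<open>The quantitative bound matters as well as the summability: iterated m times it grows
  like (|a|+|t|)^m, against which the Taylor coefficients of an entire function are
  summable.\<close>

lemma Gen_times:
  assumes s: "summable (\<lambda>n. norm (v g n * t ^ n))"
  shows "summable (\<lambda>n. norm (v (\<lambda>z. z * g z) n * t ^ n))"
    and "(\<Sum>n. norm (v (\<lambda>z. z * g z) n * t ^ n)) \<le> (norm a + norm t) * (\<Sum>n. norm (v g n * t ^ n))"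
    and "Gen (\<lambda>z. z * g z) t = a * Gen g (q * t) + t * Gen g t"
proof -
  define N where "N = (\<Sum>n. norm (v g n * t ^ n))"
  define u where "u n = (case n of 0 \<Rightarrow> 0 | Suc m \<Rightarrow> v g m * t ^ m)" for n
  note s' = summable_v_shift[OF s]
  have "(\<lambda>n. norm (u (Suc n))) sums N" "(\<lambda>n. u (Suc n)) sums Gen g t"
    using summable_sums[OF s] summable_sums[OF summable_norm_cancel[OF s]]
    unfolding N_def Gen_def u_def by simp_all
  moreover have "u 0 = 0"
    by (simp add: u_def)
  ultimately have u: "(\<lambda>n. norm (u n)) sums N" "u sums Gen g t"
    using sums_Suc[of "\<lambda>n. norm (u n)" N] sums_Suc[of u "Gen g t"] by simp_all
  have dec: "v (\<lambda>z. z * g z) n * t ^ n = a * (v g n * (q * t) ^ n) + t * u n" for n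
    unfolding u_def by (rule v_times_decomp)
  let ?b = "\<lambda>n. norm a * norm (v g n * (q * t) ^ n) + norm t * norm (u n)"
  have b: "?b sums (norm a * (\<Sum>n. norm (v g n * (q * t) ^ n)) + norm t * N)"
    by (intro sums_add sums_mult summable_sums s'(1) u(1))
  have le: "norm (v (\<lambda>z. z * g z) n * t ^ n) \<le> ?b n" for n
    unfolding dec norm_mult[symmetric] by (rule norm_triangle_ineq)
  show sz: "summable (\<lambda>n. norm (v (\<lambda>z. z * g z) n * t ^ n))"
    using summable_comparison_test'[OF sums_summable[OF b], of 0 "\<lambda>n. norm (v (\<lambda>z. z * g z) n * t ^ n)"] le by simp
  have "(\<Sum>n. norm (v (\<lambda>z. z * g z) n * t ^ n)) \<le> (\<Sum>n. ?b n)"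
    by (rule suminf_le[OF le sz sums_summable[OF b]])
  also have "\<dots> = norm a * (\<Sum>n. norm (v g n * (q * t) ^ n)) + norm t * N"
    using b by (rule sums_unique[symmetric])
  also have "\<dots> \<le> norm a * N + norm t * N"
    unfolding N_def by (intro add_right_mono mult_left_mono s'(2)) simp
  finally show "(\<Sum>n. norm (v (\<lambda>z. z * g z) n * t ^ n)) \<le> (norm a + norm t) * (\<Sum>n. norm (v g n * t ^ n))"
    unfolding N_def by (simp add: distrib_right)
  have "(\<lambda>n. v (\<lambda>z. z * g z) n * t ^ n) sums (a * Gen g (q * t) + t * Gen g t)"
    unfolding dec Gen_def[of g "q * t"]
    by (intro sums_add sums_mult summable_sums summable_norm_cancel[OF s'(1)] u(2))
  then show "Gen (\<lambda>z. z * g z) t = a * Gen g (q * t) + t * Gen g t"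
    unfolding Gen_def[of _ t] by (rule sums_unique[symmetric])
qed

lemma v_one_recurrence:
  "(1 - q ^ Suc n) * v (\<lambda>_. 1) (Suc n) =
     (d + e) * v (\<lambda>_. 1) n - d * e * (a * q ^ n * v (\<lambda>_. 1) n + (if n = 0 then 0 else v (\<lambda>_. 1) (n - 1)))"
proof -
  have "v (\<lambda>z. z) n = a * q ^ n * v (\<lambda>_. 1) n + (if n = 0 then 0 else v (\<lambda>_. 1) (n - 1))"
    using v_times_0[of "\<lambda>_. 1"] v_times_Suc[of "\<lambda>_. 1" "n - 1"] by (cases n) simp_all
  then show ?thesis
    unfolding v_one_Suc by simp
qed

text \<open>
  The convolution is the coefficient of the product $\frac{(adet;q)_\infty}{(dt,et;q)_\infty}$; it is needed only for
  the absolute convergence of the generating function.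
\<close>

lemma v_one_convolution:
  "v (\<lambda>_. 1) n = (\<Sum>i\<le>n. (qpoch (a * e) q i / qpoch q q i * d ^ i) * (1 / qpoch q q (n - i) * e ^ (n - i)))"
proof -
  define A where "A = Abs_fps (\<lambda>i. qpoch (a * e) q i / qpoch q q i * d ^ i)"
  define B where "B = Abs_fps (\<lambda>i. 1 / qpoch q q i * e ^ i)"
  \<comment> \<open>The dilation F(X) -> F(qX), a ring homomorphism. Working with formal series
    allows product identities before any convergence is known.\<close>
  define dil :: "complex fps \<Rightarrow> complex fps" where "dil F = Abs_fps (\<lambda>n. q ^ n * F $ n)" for F
  have dil_mult: "dil (F * G) = dil F * dil G" for F G
  proof (rule fps_ext)
    fix n
    have 1: "q ^ i * F $ i * (q ^ (n - i) * G $ (n - i)) = q ^ n * (F $ i * G $ (n - i))" if "i \<le> n" for i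
      using that power_add[of q i "n - i"] by (simp add: mult_ac)
    show "dil (F * G) $ n = (dil F * dil G) $ n"
      unfolding dil_def fps_mult_nth fps_nth_Abs_fps sum_distrib_left
      by (rule sum.cong[OF refl], rule 1[symmetric]) simp
  qed
  have nz: "1 - q * q ^ k \<noteq> 0" for k
    using qpoch_q_nonzero[of "Suc k"] unfolding qpoch_Suc by simp
  \<comment> \<open>A is the formal series of (adeX;q)_\<infinity> / (dX;q)_\<infinity> and B that
    of 1/(eX;q)_\<infinity>; each is handled through its first-order equation under X -> qX.\<close>
  have "(dil A * (1 - fps_const (a * d * e) * fps_X)) $ n = (A * (1 - fps_const d * fps_X)) $ n" for n
    unfolding fps_nth_mult_one_minus_X unfolding A_def dil_def
    using nz by (cases n) (simp_all add: qpoch_Suc divide_simps, simp add: algebra_simps)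
  then have dA: "dil A * (1 - fps_const (a * d * e) * fps_X) = A * (1 - fps_const d * fps_X)"
    by (rule fps_ext)
  have "dil B $ n = (B * (1 - fps_const e * fps_X)) $ n" for n
    unfolding fps_nth_mult_one_minus_X unfolding B_def dil_def
    using nz by (cases n) (simp_all add: qpoch_Suc divide_simps, simp add: algebra_simps)
  then have dB: "dil B = B * (1 - fps_const e * fps_X)"
    by (rule fps_ext)
  define H where "H = A * B"
  have "dil H * (1 - fps_const (a * d * e) * fps_X) = dil A * (1 - fps_const (a * d * e) * fps_X) * dil B"
    unfolding H_def dil_mult by (simp only: mult_ac)
  also have "\<dots> = H * (1 - fps_const d * fps_X) * (1 - fps_const e * fps_X)"
    unfolding dA dB H_def by (simp only: mult_ac)
  finally have coeff: "(dil H * (1 - fps_const (a * d * e) * fps_X)) $ Suc n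
      = (H * (1 - fps_const d * fps_X) * (1 - fps_const e * fps_X)) $ Suc n" for n
    by simp
  have rec: "(1 - q ^ Suc n) * H $ Suc n =
      (d + e) * H $ n - d * e * (a * q ^ n * H $ n + (if n = 0 then 0 else H $ (n - 1)))" for n
    using coeff[of n] unfolding fps_nth_mult_one_minus_X unfolding dil_def
    by (cases n) (simp_all add: algebra_simps)
  have "v (\<lambda>_. 1) n = H $ n"
  \<comment> \<open>The recurrence reaches back two indices, hence strong induction; 1 - q^{m+1} is
    nonzero, so it determines each coefficient.\<close>
  proof (induction n rule: less_induct)
    case (less n)
    show ?case
    proof (cases n)
      case 0
      then show ?thesis by (simp add: v_one_0 H_def A_def B_def)
    next
      case (Suc m)
      then have "(1 - q ^ Suc m) * v (\<lambda>_. 1) (Suc m) = (1 - q ^ Suc m) * H $ Suc m"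
        unfolding v_one_recurrence rec using less.IH[of m] less.IH[of "m - 1"] by simp
      then show ?thesis using nz[of m] Suc by simp
    qed
  qed
  then show ?thesis
    unfolding H_def fps_mult_nth A_def B_def by (simp add: atMost_atLeast0)
qed

text \<open>The convolution is dominated by the Cauchy product of two series that converge
  absolutely because |td| < 1 and |te| < 1.\<close>

lemma summable_v_one:
  assumes "norm t < 1"
  shows "summable (\<lambda>n. norm (v (\<lambda>_. 1) n * t ^ n))"
proof -
  define f where "f i = norm (qpoch (a * e) q i / qpoch q q i * (t * d) ^ i)" for i
  define g where "g i = norm (1 / qpoch q q i * (t * e) ^ i)" for i
  have conv: "convergent (\<lambda>i. qpoch x q i / qpoch q q i)" for x
    using tendsto_divide[OF qpoch_tendsto qpoch_tendsto qpoch_inf_q_nonzero] by (rule convergentI)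
  have "summable f"
    unfolding f_def
    by (rule summable_norm_convergent_times_power[OF conv norm_mult_lt_1[OF assms norm_d]])
  moreover have "summable g"
    unfolding g_def
    using summable_norm_convergent_times_power[OF conv[of 0] norm_mult_lt_1[OF assms norm_e]] by simp
  moreover have "f i \<ge> 0" "g i \<ge> 0" for i
    by (simp_all add: f_def g_def)
  ultimately have s: "summable (\<lambda>n. \<Sum>i\<le>n. f i * g (n - i))"
    by (intro summable_Cauchy_product) simp_all
  have "norm (v (\<lambda>_. 1) n * t ^ n) \<le> (\<Sum>i\<le>n. f i * g (n - i))" for n
    unfolding v_one_convolution sum_distrib_right
  proof (rule order_trans[OF norm_sum], rule sum_mono)
    fix i assume "i \<in> {..n}"
    then have "norm t ^ n = norm t ^ i * norm t ^ (n - i)"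
      by (simp flip: power_add)
    then show "norm (qpoch (a * e) q i / qpoch q q i * d ^ i * (1 / qpoch q q (n - i) * e ^ (n - i)) * t ^ n) \<le> f i * g (n - i)"
      unfolding f_def g_def by (simp add: norm_mult norm_divide norm_power power_mult_distrib mult_ac)
  qed
  then show ?thesis
    using summable_comparison_test'[OF s, of 0 "\<lambda>n. norm (v (\<lambda>_. 1) n * t ^ n)"] by simp
qed

text \<open>Multiplying \<open>v_one_Suc\<close> by t^{n+1} and summing, the factor 1 - q^{n+1}
  produces the difference of the values at t and qt. Inserting \<open>Gen_times\<close> leaves the
  same equation as in \<open>J_one_shift\<close>.\<close>

lemma Gen_one_shift:
  assumes "norm t < 1"
  shows "(1 - a * t * d * e) * Gen (\<lambda>_. 1) (q * t) = (1 - t * d) * (1 - t * e) * Gen (\<lambda>_. 1) t"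
proof -
  note s = summable_v_one[OF assms]
  note sums1 = summable_sums[OF summable_norm_cancel[OF s], folded Gen_def]
  note sums2 = summable_sums[OF summable_norm_cancel[OF summable_v_shift(1)[OF s]], folded Gen_def]
  note sumsz = summable_sums[OF summable_norm_cancel[OF Gen_times(1)[OF s]], folded Gen_def]
  have "(\<lambda>n. t * ((d + e) * (v (\<lambda>_. 1) n * t ^ n) - d * e * (v (\<lambda>z. z * 1) n * t ^ n)))
      sums (t * ((d + e) * Gen (\<lambda>_. 1) t - d * e * Gen (\<lambda>z. z * 1) t))"
    by (intro sums_mult sums_diff sums1 sumsz)
  moreover have "t * ((d + e) * (v (\<lambda>_. 1) n * t ^ n) - d * e * (v (\<lambda>z. z * 1) n * t ^ n))
      = v (\<lambda>_. 1) (Suc n) * t ^ Suc n - v (\<lambda>_. 1) (Suc n) * (q * t) ^ Suc n" for n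
  proof -
    have "t * ((d + e) * (v (\<lambda>_. 1) n * t ^ n) - d * e * (v (\<lambda>z. z * 1) n * t ^ n))
      = ((1 - q ^ Suc n) * v (\<lambda>_. 1) (Suc n)) * t ^ Suc n"
      unfolding v_one_Suc by (simp add: algebra_simps)
    then show ?thesis
      by (simp add: algebra_simps power_mult_distrib)
  qed
  ultimately have "(\<lambda>n. v (\<lambda>_. 1) (Suc n) * t ^ Suc n - v (\<lambda>_. 1) (Suc n) * (q * t) ^ Suc n)
      sums (t * ((d + e) * Gen (\<lambda>_. 1) t - d * e * Gen (\<lambda>z. z * 1) t))"
    by simp
  \<comment> \<open>Including index 0 leaves the sum unchanged, since its term is v_0 - v_0 =
    0.\<close>
  from sums_Suc[OF this] have "(\<lambda>n. v (\<lambda>_. 1) n * t ^ n - v (\<lambda>_. 1) n * (q * t) ^ n)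
      sums (t * ((d + e) * Gen (\<lambda>_. 1) t - d * e * Gen (\<lambda>z. z * 1) t))"
    by simp
  from sums_unique2[OF sums_diff[OF sums1 sums2] this]
  have "Gen (\<lambda>_. 1) t - Gen (\<lambda>_. 1) (q * t)
      = t * ((d + e) * Gen (\<lambda>_. 1) t - d * e * (a * Gen (\<lambda>_. 1) (q * t) + t * Gen (\<lambda>_. 1) t))"
    unfolding Gen_times(3)[OF s] .
  then show ?thesis by (simp add: algebra_simps)
qed

section \<open>Agreement of Gen and J: the constant 1, monomials, entire functions\<close>

lemma Gen_one_tendsto:
  assumes "norm t < 1" and "t \<noteq> 0"
  shows "(\<lambda>N. Gen (\<lambda>_. 1) (t * q ^ N)) \<longlonglongrightarrow> 1"
proof -
  have "(Gen (\<lambda>_. 1) \<longlongrightarrow> v (\<lambda>_. 1) 0) (at 0)"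
    unfolding Gen_def
    by (rule powser_limit_0[of 1]) (simp_all add: summable_sums summable_norm_cancel summable_v_one)
  moreover have "filterlim (\<lambda>N. t * q ^ N) (at 0) sequentially"
    unfolding filterlim_at using tendsto_mult[OF tendsto_const[of t] q_power_tendsto_0] assms by simp
  ultimately show ?thesis
    unfolding v_one_0 by (rule filterlim_compose)
qed

text \<open>A factor 1 - atdeq^j may vanish, so the iterated equation is kept as a product identity
  instead of being divided by (atde;q)_N. Its left side tends to 0, and (td,te;q)_\<infinity> is
  nonzero.\<close>

lemma Gen_one_eq_J:
  assumes "admissible t"
  shows "Gen (\<lambda>_. 1) t = J (\<lambda>_. 1) t"
proof -
  define D where "D t = Gen (\<lambda>_. 1) t - J (\<lambda>_. 1) t" for t
  have step: "(1 - a * t * d * e) * D (q * t) = (1 - t * d) * (1 - t * e) * D t" if "admissible t" for t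
    using J_one_shift[OF that] Gen_one_shift[of t] that
    by (simp add: D_def right_diff_distrib admissible_def)
  have iter: "qpoch (a * t * d * e) q N * D (t * q ^ N) = qpoch (t * d) q N * qpoch (t * e) q N * D t" for N
  proof (induction N)
    case (Suc N)
    have "qpoch (a * t * d * e) q (Suc N) * D (t * q ^ Suc N)
       = qpoch (a * t * d * e) q N * ((1 - a * (t * q ^ N) * d * e) * D (q * (t * q ^ N)))"
      unfolding qpoch_Suc by (simp add: mult_ac)
    also have "\<dots> = qpoch (a * t * d * e) q N * ((1 - (t * q ^ N) * d) * (1 - (t * q ^ N) * e) * D (t * q ^ N))"
      by (simp only: step[OF admissible_power[OF assms]])
    also have "\<dots> = (1 - (t * q ^ N) * d) * (1 - (t * q ^ N) * e) * (qpoch (a * t * d * e) q N * D (t * q ^ N))"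
      by (simp only: mult_ac)
    also have "\<dots> = qpoch (t * d) q (Suc N) * qpoch (t * e) q (Suc N) * D t"
      unfolding Suc.IH qpoch_Suc by (simp add: mult_ac)
    finally show ?case .
  qed simp
  have "t \<noteq> 0" "norm t < 1"
    using assms by (auto simp: admissible_def)
  then have "(\<lambda>N. D (t * q ^ N)) \<longlonglongrightarrow> 1 - 1"
    unfolding D_def by (intro tendsto_diff Gen_one_tendsto J_one_tendsto assms)
  from tendsto_mult[OF qpoch_tendsto[of "a * t * d * e"] this]
  have "(\<lambda>N. qpoch (t * d) q N * qpoch (t * e) q N * D t) \<longlonglongrightarrow> 0"
    unfolding iter by simp
  moreover have "(\<lambda>N. qpoch (t * d) q N * qpoch (t * e) q N * D t) \<longlonglongrightarrow>
      qpoch_inf (t * d) q * qpoch_inf (t * e) q * D t"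
    by (intro tendsto_mult qpoch_tendsto tendsto_const)
  ultimately have "qpoch_inf (t * d) q * qpoch_inf (t * e) q * D t = 0"
    using LIMSEQ_unique by blast
  then show ?thesis
    using admissible_nonzero(8,9)[OF assms] by (simp add: D_def)
qed

lemma monomial:
  shows summable_v_monomial: "norm t < 1 \<Longrightarrow> summable (\<lambda>n. norm (v (\<lambda>z. z ^ m) n * t ^ n))"
    and suminf_v_monomial_le: "norm t < 1 \<Longrightarrow> (\<Sum>n. norm (v (\<lambda>z. z ^ m) n * t ^ n)) \<le>
      (norm a + norm t) ^ m * (\<Sum>n. norm (v (\<lambda>_. 1) n * t ^ n))"
    and Gen_monomial: "admissible t \<Longrightarrow> Gen (\<lambda>z. z ^ m) t = J (\<lambda>z. z ^ m) t"
\<comment> \<open>t is generalized because the value at t for one power uses the values at t and at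
  qt for the previous one.\<close>
proof (induction m arbitrary: t)
  case 0
  {
    case 1
    then show ?case by (simp add: summable_v_one)
  next
    case 2
    then show ?case by simp
  next
    case 3
    then show ?case by (simp add: Gen_one_eq_J)
  }
next
  case (Suc m)
  {
    case 1
    then show ?case using Gen_times(1)[OF Suc.IH(1)] by simp
  next
    case 2
    have "(\<Sum>n. norm (v (\<lambda>z. z ^ Suc m) n * t ^ n)) \<le> (norm a + norm t) * (\<Sum>n. norm (v (\<lambda>z. z ^ m) n * t ^ n))"
      using Gen_times(2)[OF Suc.IH(1)[OF 2]] by simp
    also have "\<dots> \<le> (norm a + norm t) * ((norm a + norm t) ^ m * (\<Sum>n. norm (v (\<lambda>_. 1) n * t ^ n)))"
      by (intro mult_left_mono Suc.IH(2) 2) simp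
    finally show ?case by simp
  next
    case 3
    then have "norm t < 1"
      by (simp add: admissible_def)
    have c: "isCont (\<lambda>z::complex. z ^ m) 0"
      by (intro continuous_intros)
    show ?case
      unfolding power_Suc Gen_times(3)[OF Suc.IH(1)[OF \<open>norm t < 1\<close>]] J_times[OF 3 c]
        Suc.IH(3)[OF 3] Suc.IH(3)[OF admissible_shift[OF 3]] ..
  }
qed

lemma v_sums:
  assumes "\<And>z. (\<lambda>m. c m * z ^ m) sums g z"
  shows "(\<lambda>m. c m * v (\<lambda>z. z ^ m) n) sums v g n"
proof -
  define u where "u k = inverse (a ^ n) / qpoch q q n * (qpoch (inverse (q ^ n)) q k * (qpoch (a * d) q k * qpoch (a * e) q k / qpoch q q k) * q ^ k)" for k
  have v: "v h n = (\<Sum>k\<le>n. u k * h (a * q ^ k))" for h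
    unfolding v_def u_def by (simp add: sum_distrib_left mult.assoc)
  have "(\<lambda>m. \<Sum>k\<le>n. u k * (c m * (a * q ^ k) ^ m)) sums (\<Sum>k\<le>n. u k * g (a * q ^ k))"
    by (intro sums_sum sums_mult assms)
  then show ?thesis
    unfolding v by (simp add: sum_distrib_left mult.left_commute)
qed

lemma Gen_entire:
  assumes "g holomorphic_on UNIV"
  shows summable_v_entire: "norm t < 1 \<Longrightarrow> summable (\<lambda>n. norm (v g n * t ^ n))"
    and Gen_entire_eq_J: "admissible t \<Longrightarrow> Gen g t = J g t"
proof -
  obtain c where c: "\<And>z. (\<lambda>m. c m * z ^ m) sums g z"
    and cs: "\<And>R. R \<ge> 0 \<Longrightarrow> summable (\<lambda>m. norm (c m) * R ^ m)"
    using entire_power_series[OF assms] by blast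
  have swap: "summable (\<lambda>n. norm (v g n * t ^ n))"
    "(\<lambda>n. v g n * t ^ n) sums (\<Sum>m. c m * Gen (\<lambda>z. z ^ m) t)" if t: "norm t < 1" for t
  proof -
    define f where "f m n = c m * (v (\<lambda>z. z ^ m) n * t ^ n)" for m n
    define N where "N = (\<Sum>n. norm (v (\<lambda>_. 1) n * t ^ n))"
    note sv = summable_v_monomial[OF t]
    have sf: "summable (\<lambda>n. norm (f m n))" for m
      unfolding f_def norm_mult[of "c m"] by (rule summable_mult[OF sv])
    \<comment> \<open>Summing over m requires the Taylor series at the radius |a| + |t|, which is
      unrestricted through a; entirety of g supplies this.\<close>
    have "(\<Sum>n. norm (f m n)) \<le> norm (c m) * ((norm a + norm t) ^ m * N)" for m
      unfolding f_def norm_mult[of "c m"] suminf_mult[OF sv] N_def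
      by (intro mult_left_mono suminf_v_monomial_le t) simp
    then have sum_sf: "summable (\<lambda>m. \<Sum>n. norm (f m n))"
      using summable_comparison_test'[OF summable_mult2[OF cs[of "norm a + norm t"], of N], of 0 "\<lambda>m. \<Sum>n. norm (f m n)"]
        suminf_nonneg[OF sf] by (simp add: mult.assoc)
    have fv: "(\<Sum>m. f m n) = v g n * t ^ n" for n
      using sums_unique[OF sums_mult2[OF v_sums[OF c], of n "t ^ n"]] unfolding f_def by (simp add: mult.assoc)
    have fg: "(\<Sum>n. f m n) = c m * Gen (\<lambda>z. z ^ m) t" for m
      unfolding f_def Gen_def by (rule suminf_mult[OF summable_norm_cancel[OF sv]])
    show "summable (\<lambda>n. norm (v g n * t ^ n))" "(\<lambda>n. v g n * t ^ n) sums (\<Sum>m. c m * Gen (\<lambda>z. z ^ m) t)"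
      using sums_swap(2,1)[OF sf sum_sf] unfolding fv fg .
  qed
  show "summable (\<lambda>n. norm (v g n * t ^ n))" if "norm t < 1"
    using swap(1)[OF that] .
  show "Gen g t = J g t" if adm: "admissible t"
  proof -
    have t: "norm t < 1"
      using adm by (simp add: admissible_def)
    have x: "norm (x * q ^ k) \<le> norm x" for x k
      using norm_q mult_left_mono[of "norm q ^ k" 1 "norm x"] by (simp add: norm_mult norm_power power_le_one)
    have sw: "summable (\<lambda>k. norm (weight_a t k))" "summable (\<lambda>k. norm (weight_t t k))"
      using summable_weights[OF adm, of "\<lambda>_. 1"] by (simp_all add: convergent_const)
    have "(\<lambda>m. c m * (\<Sum>k. weight_a t k * (a * q ^ k) ^ m) + c m * (\<Sum>k. weight_t t k * (t * q ^ k) ^ m)) sums J g t"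
      unfolding J_def
      by (intro sums_add power_series_sums_swap[OF c cs[OF norm_ge_zero] sw(1) x]
            power_series_sums_swap[OF c cs[OF norm_ge_zero] sw(2) x])
    then have "(\<lambda>m. c m * Gen (\<lambda>z. z ^ m) t) sums J g t"
      unfolding Gen_monomial[OF adm] J_def distrib_left .
    then show ?thesis
      using sums_unique[OF swap(2)[OF t]] unfolding Gen_def[of g] by (simp add: sums_iff)
  qed
qed

subsection \<open>General $\gamma$\<close>

text \<open>Comparing coefficients of \<gamma>^{m+1} expresses (1 - q^{m+1}) times the coefficient
  at t through the m-th coefficients at t and qt. Both vanish by induction over all admissible t,
  starting from \<gamma> = 0.\<close>

lemma entire_q_difference_unique:
  fixes D :: "complex \<Rightarrow> complex \<Rightarrow> complex"
  assumes hol: "\<And>t. admissible t \<Longrightarrow> (\<lambda>\<gamma>. D \<gamma> t) holomorphic_on UNIV"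
    and zero: "\<And>t. admissible t \<Longrightarrow> D 0 t = 0"
    and rec: "\<And>\<gamma> t. admissible t \<Longrightarrow> D \<gamma> t = (1 - \<gamma>) * D (q * \<gamma>) t + \<gamma> * D \<gamma> (q * t)"
    and adm: "admissible t"
  shows "D \<gamma> t = 0"
proof -
  define c where "c t m = (deriv ^^ m) (\<lambda>\<gamma>. D \<gamma> t) 0 / fact m" for t m
  have c: "(\<lambda>m. c t m * \<gamma> ^ m) sums D \<gamma> t" if "admissible t" for t \<gamma>
    using holomorphic_power_series[of "\<lambda>\<gamma>. D \<gamma> t" 0 "norm \<gamma> + 1" \<gamma>] holomorphic_on_subset[OF hol[OF that]]
    unfolding c_def by simp
  have "c t m = 0" if "admissible t" for m t
    using that
  proof (induction m arbitrary: t)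
    case 0
    then show ?case using zero by (simp add: c_def)
  next
    case (Suc m)
    note t = Suc.prems
    \<comment> \<open>The \<open>case\<close> with default 0 encodes multiplication by \<gamma>,
      which shifts coefficients up by one.\<close>
    have "(c t m' - q ^ m' * c t m' + (case m' of 0 \<Rightarrow> 0 | Suc k \<Rightarrow> q ^ k * c t k - c (q * t) k)) = 0" for m'
    proof (rule powser_eq_0)
      fix \<gamma>
      have "(\<lambda>k. \<gamma> * (c t k * (q * \<gamma>) ^ k - c (q * t) k * \<gamma> ^ k)) sums (\<gamma> * (D (q * \<gamma>) t - D \<gamma> (q * t)))"
        by (intro sums_mult sums_diff c t admissible_shift)
      then have "(\<lambda>m. (case m of 0 \<Rightarrow> 0 | Suc k \<Rightarrow> q ^ k * c t k - c (q * t) k) * \<gamma> ^ m) sums (\<gamma> * (D (q * \<gamma>) t - D \<gamma> (q * t)))"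
        using sums_Suc[of "\<lambda>m. (case m of 0 \<Rightarrow> 0 | Suc k \<Rightarrow> q ^ k * c t k - c (q * t) k) * \<gamma> ^ m"]
        by (simp add: algebra_simps power_mult_distrib)
      then have "(\<lambda>m. (c t m * \<gamma> ^ m - c t m * (q * \<gamma>) ^ m) + (case m of 0 \<Rightarrow> 0 | Suc k \<Rightarrow> q ^ k * c t k - c (q * t) k) * \<gamma> ^ m)
          sums ((D \<gamma> t - D (q * \<gamma>) t) + \<gamma> * (D (q * \<gamma>) t - D \<gamma> (q * t)))"
        by (intro sums_add sums_diff c t)
      moreover have "(D \<gamma> t - D (q * \<gamma>) t) + \<gamma> * (D (q * \<gamma>) t - D \<gamma> (q * t)) = 0"
        using rec[OF t, of \<gamma>] by (simp add: algebra_simps)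
      ultimately show "(\<lambda>m. (c t m - q ^ m * c t m + (case m of 0 \<Rightarrow> 0 | Suc k \<Rightarrow> q ^ k * c t k - c (q * t) k)) * \<gamma> ^ m) sums 0"
        by (simp add: algebra_simps power_mult_distrib)
    qed
    from this[of "Suc m"] have "(1 - q ^ Suc m) * c t (Suc m) = 0"
      using Suc.IH[OF t] Suc.IH[OF admissible_shift[OF t]] by (simp add: algebra_simps)
    moreover have "1 - q ^ Suc m \<noteq> 0"
      using qpoch_q_nonzero[of "Suc m"] unfolding qpoch_Suc by simp
    ultimately show ?case by simp
  qed
  then show ?thesis
    using c[OF adm, of \<gamma>] adm by (simp add: sums_iff)
qed

lemma summable_qpoch_times:
  assumes "summable (\<lambda>n. norm (u n))"
  shows "summable (\<lambda>n. qpoch x q n * u n)"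
proof (rule summable_norm_cancel, rule summable_comparison_test')
  show "summable (\<lambda>n. exp (norm x / (1 - norm q)) * norm (u n))"
    using assms by (rule summable_mult)
  show "norm (norm (qpoch x q n * u n)) \<le> exp (norm x / (1 - norm q)) * norm (u n)" for n
    using norm_qpoch_le[of x n] by (simp add: norm_mult mult_right_mono)
qed

definition GenQ :: "(complex \<Rightarrow> complex) \<Rightarrow> complex \<Rightarrow> complex \<Rightarrow> complex" where
  "GenQ g \<gamma> t = (\<Sum>n. qpoch \<gamma> q n * (v g n * t ^ n))"

text \<open>The prefactors of the claimed formula are kept outside the sums, and \<gamma> (t/a) is
  bracketed as x * s to fit \<open>entire_qpoch_series\<close>. At \<gamma> = 0 this is J.\<close>

definition JQ :: "(complex \<Rightarrow> complex) \<Rightarrow> complex \<Rightarrow> complex \<Rightarrow> complex" where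
  "JQ g \<gamma> t = qpoch_inf (\<gamma> * (t / a)) q * (\<Sum>k. qpoch \<gamma> q k * (weight_a t k * g (a * q ^ k)))
     + qpoch_inf \<gamma> q * (\<Sum>k. qpoch (\<gamma> * (t / a)) q k * (weight_t t k * g (t * q ^ k)))"

text \<open>Holds term by term: (1-\<gamma>)(q\<gamma>;q)_n = (\<gamma>;q)_n (1-\<gamma>q^n), and
  the dilation of t restores the missing \<gamma>q^n.\<close>

lemma GenQ_recurrence:
  assumes "summable (\<lambda>n. norm (v g n * t ^ n))"
  shows "GenQ g \<gamma> t = (1 - \<gamma>) * GenQ g (q * \<gamma>) t + \<gamma> * GenQ g \<gamma> (q * t)"
proof -
  have "(\<lambda>n. (1 - \<gamma>) * (qpoch (q * \<gamma>) q n * (v g n * t ^ n)) + \<gamma> * (qpoch \<gamma> q n * (v g n * (q * t) ^ n)))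
      sums ((1 - \<gamma>) * GenQ g (q * \<gamma>) t + \<gamma> * GenQ g \<gamma> (q * t))"
    unfolding GenQ_def
    by (intro sums_add sums_mult summable_sums summable_qpoch_times assms summable_v_shift(1))
  moreover have "(1 - \<gamma>) * (qpoch (q * \<gamma>) q n * (v g n * t ^ n)) + \<gamma> * (qpoch \<gamma> q n * (v g n * (q * t) ^ n))
      = qpoch \<gamma> q n * (v g n * t ^ n)" for n
    unfolding mult.assoc[symmetric, of "1 - \<gamma>"] qpoch_shift by (simp add: algebra_simps power_mult_distrib)
  ultimately show ?thesis
    by (simp add: sums_iff GenQ_def)
qed

text \<open>Each orbit satisfies the equation separately. On the a-orbit the brackets combine to 1 -
  \<gamma>q^k + \<gamma>(q^k - s) = 1 - \<gamma>s, which completes (q\<gamma>s;q)_\<infinity> to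
  (\<gamma>s;q)_\<infinity>. On the t-orbit the same cancellation occurs after an index
  shift.\<close>

lemma JQ_recurrence:
  assumes "admissible t" and "isCont g 0"
  shows "JQ g \<gamma> t = (1 - \<gamma>) * JQ g (q * \<gamma>) t + \<gamma> * JQ g \<gamma> (q * t)"
proof -
  define s where "s = t / a"
  define \<alpha> where "\<alpha> t k = weight_a t k * g (a * q ^ k)" for t k
  define \<beta> where "\<beta> t k = weight_t t k * g (t * q ^ k)" for t k
  note adm = assms(1) admissible_shift[OF assms(1)]
  have sum: "summable (\<lambda>k. qpoch x q k * \<alpha> t k)" "summable (\<lambda>k. qpoch x q k * \<beta> t k)" if "admissible t" for x t
    unfolding \<alpha>_def \<beta>_def
    by (intro summable_qpoch_times summable_weights that convergent_along_powers assms(2))+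
  have "weight_a (q * t) k = (q ^ k - s) * weight_a t k" for k
    using weight_a_shift[OF assms(1), of k] unfolding s_def by (simp add: field_simps)
  then have \<alpha>: "\<alpha> (q * t) k = (q ^ k - s) * \<alpha> t k" for k
    unfolding \<alpha>_def by simp
  have "weight_t (q * t) k = s * (q ^ Suc k - 1) * weight_t t (Suc k)" for k
    using weight_t_shift[OF assms(1), of k] unfolding s_def by (simp add: field_simps)
  then have \<beta>: "\<beta> (q * t) k = s * (q ^ Suc k - 1) * \<beta> t (Suc k)" for k
    unfolding \<beta>_def by (simp add: mult_ac)
  have "(1 - \<gamma>) * (qpoch_inf (q * \<gamma> * s) q * (\<Sum>k. qpoch (q * \<gamma>) q k * \<alpha> t k))
      + \<gamma> * (qpoch_inf (q * \<gamma> * s) q * (\<Sum>k. qpoch \<gamma> q k * \<alpha> (q * t) k))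
      = qpoch_inf (q * \<gamma> * s) q * ((\<Sum>k. (1 - \<gamma>) * (qpoch (q * \<gamma>) q k * \<alpha> t k)) + (\<Sum>k. \<gamma> * (qpoch \<gamma> q k * \<alpha> (q * t) k)))"
    by (simp add: suminf_mult sum adm distrib_left mult.left_commute)
  also have "(\<Sum>k. (1 - \<gamma>) * (qpoch (q * \<gamma>) q k * \<alpha> t k)) + (\<Sum>k. \<gamma> * (qpoch \<gamma> q k * \<alpha> (q * t) k))
      = (\<Sum>k. (1 - \<gamma>) * (qpoch (q * \<gamma>) q k * \<alpha> t k) + \<gamma> * (qpoch \<gamma> q k * \<alpha> (q * t) k))"
    by (intro suminf_add summable_mult sum adm)
  also have "\<dots> = (\<Sum>k. (1 - \<gamma> * s) * (qpoch \<gamma> q k * \<alpha> t k))"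
    unfolding \<alpha> mult.assoc[symmetric, of "1 - \<gamma>"] qpoch_shift by (simp add: algebra_simps)
  also have "\<dots> = (1 - \<gamma> * s) * (\<Sum>k. qpoch \<gamma> q k * \<alpha> t k)"
    by (intro suminf_mult sum adm)
  also have "qpoch_inf (q * \<gamma> * s) q * \<dots> = qpoch_inf (\<gamma> * s) q * (\<Sum>k. qpoch \<gamma> q k * \<alpha> t k)"
    unfolding qpoch_inf_shift[of "\<gamma> * s"] by (simp add: mult_ac)
  finally have A: "(1 - \<gamma>) * (qpoch_inf (q * \<gamma> * s) q * (\<Sum>k. qpoch (q * \<gamma>) q k * \<alpha> t k))
      + \<gamma> * (qpoch_inf (q * \<gamma> * s) q * (\<Sum>k. qpoch \<gamma> q k * \<alpha> (q * t) k))
      = qpoch_inf (\<gamma> * s) q * (\<Sum>k. qpoch \<gamma> q k * \<alpha> t k)" .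
  have "(\<Sum>k. qpoch (q * \<gamma> * s) q k * \<beta> t k) + \<gamma> * (\<Sum>k. qpoch (q * \<gamma> * s) q k * \<beta> (q * t) k)
      = (\<Sum>k. qpoch (\<gamma> * s) q k * \<beta> t k)"
  proof -
    \<comment> \<open>Aligns the orbit of qt with that of t; the default 0 stands for the point z =
      t, which the former lacks.\<close>
    define e' where "e' k = (case k of 0 \<Rightarrow> 0 | Suc m \<Rightarrow> \<gamma> * (qpoch (q * \<gamma> * s) q m * \<beta> (q * t) m))" for k
    have "(\<lambda>k. e' (Suc k)) sums (\<gamma> * (\<Sum>k. qpoch (q * \<gamma> * s) q k * \<beta> (q * t) k))"
      unfolding e'_def by (simp add: sums_mult summable_sums sum adm)
    moreover have "e' 0 = 0"
      by (simp add: e'_def)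
    ultimately have "e' sums (\<gamma> * (\<Sum>k. qpoch (q * \<gamma> * s) q k * \<beta> (q * t) k))"
      using sums_Suc[of e'] by fastforce
    then have "(\<lambda>k. qpoch (q * \<gamma> * s) q k * \<beta> t k + e' k) sums
      ((\<Sum>k. qpoch (q * \<gamma> * s) q k * \<beta> t k) + \<gamma> * (\<Sum>k. qpoch (q * \<gamma> * s) q k * \<beta> (q * t) k))"
      by (intro sums_add summable_sums sum adm)
    moreover have "qpoch (q * \<gamma> * s) q k * \<beta> t k + e' k = qpoch (\<gamma> * s) q k * \<beta> t k" for k
    proof (cases k)
      case (Suc m)
      have 1: "qpoch (\<gamma> * s) q (Suc m) = (1 - \<gamma> * s) * qpoch (q * \<gamma> * s) q m"
        unfolding qpoch_Suc_left by (simp add: mult_ac)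
      show ?thesis
        unfolding Suc 1 qpoch_Suc[of "q * \<gamma> * s"] e'_def nat.case \<beta> by (simp add: algebra_simps)
    qed (simp add: e'_def)
    ultimately show ?thesis by (simp add: sums_iff)
  qed
  then have "qpoch_inf \<gamma> q * (\<Sum>k. qpoch (\<gamma> * s) q k * \<beta> t k)
      = qpoch_inf \<gamma> q * ((\<Sum>k. qpoch (q * \<gamma> * s) q k * \<beta> t k) + \<gamma> * (\<Sum>k. qpoch (q * \<gamma> * s) q k * \<beta> (q * t) k))"
    by simp
  then have B: "qpoch_inf \<gamma> q * (\<Sum>k. qpoch (\<gamma> * s) q k * \<beta> t k)
      = (1 - \<gamma>) * (qpoch_inf (q * \<gamma>) q * (\<Sum>k. qpoch (q * \<gamma> * s) q k * \<beta> t k))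
      + \<gamma> * (qpoch_inf \<gamma> q * (\<Sum>k. qpoch (q * \<gamma> * s) q k * \<beta> (q * t) k))"
    unfolding mult.assoc[symmetric, of "1 - \<gamma>"] qpoch_inf_shift[of \<gamma>, symmetric]
    by (simp only: distrib_left mult.left_commute)
  \<comment> \<open>Dilating \<gamma> or t changes \<gamma>t/a in the same way, so both terms on the
    right share the factor (q\<gamma>s;q)_\<infinity>.\<close>
  have s': "q * \<gamma> * (t / a) = q * \<gamma> * s" "\<gamma> * (q * t / a) = q * \<gamma> * s"
    by (simp_all add: s_def)
  show ?thesis
    unfolding JQ_def s' s_def[symmetric] \<alpha>_def[symmetric] \<beta>_def[symmetric] A[symmetric] B
    by (simp add: algebra_simps)
qed

lemma GenQ_eq_JQ:
  assumes hol: "g holomorphic_on UNIV" and adm: "admissible t"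
  shows "GenQ g \<gamma> t = JQ g \<gamma> t"
proof -
  have cont: "isCont g 0"
    using holomorphic_on_imp_continuous_on[OF hol] by (simp add: continuous_on_eq_continuous_at)
  have norm: "norm t < 1" if "admissible t" for t
    using that by (simp add: admissible_def)
  have "GenQ g \<gamma> t - JQ g \<gamma> t = 0"
  proof (rule entire_q_difference_unique[where D = "\<lambda>\<gamma> t. GenQ g \<gamma> t - JQ g \<gamma> t", OF _ _ _ adm])
    fix t assume t: "admissible t"
    \<comment> \<open>The explicit factor 1 exhibits \<gamma> in the form x * s with s = 1.\<close>
    have "(\<lambda>\<gamma>. \<Sum>n. qpoch (\<gamma> * 1) q n * (v g n * t ^ n)) holomorphic_on UNIV"
      "(\<lambda>\<gamma>. \<Sum>k. qpoch (\<gamma> * 1) q k * (weight_a t k * g (a * q ^ k))) holomorphic_on UNIV"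
      "(\<lambda>\<gamma>. \<Sum>k. qpoch (\<gamma> * (t / a)) q k * (weight_t t k * g (t * q ^ k))) holomorphic_on UNIV"
      "(\<lambda>\<gamma>. qpoch_inf (\<gamma> * 1) q) holomorphic_on UNIV"
      by (intro entire_qpoch_series entire_qpoch_inf summable_v_entire hol norm[OF t]
          summable_weights t convergent_along_powers cont)+
    then show "(\<lambda>\<gamma>. GenQ g \<gamma> t - JQ g \<gamma> t) holomorphic_on UNIV"
      unfolding GenQ_def JQ_def mult_1_right
      by (intro holomorphic_on_diff holomorphic_on_add holomorphic_on_mult entire_qpoch_inf)
    show "GenQ g 0 t - JQ g 0 t = 0"
      using Gen_entire_eq_J[OF hol t] by (simp add: GenQ_def JQ_def Gen_def J_def qpoch_inf_def)
    show "GenQ g \<gamma> t - JQ g \<gamma> t = (1 - \<gamma>) * (GenQ g (q * \<gamma>) t - JQ g (q * \<gamma>) t) + \<gamma> * (GenQ g \<gamma> (q * t) - JQ g \<gamma> (q * t))" for \<gamma>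
      by (subst GenQ_recurrence[OF summable_v_entire[OF hol norm[OF t]], of \<gamma>], subst JQ_recurrence[OF t cont, of \<gamma>])
         (simp add: algebra_simps)
  qed
  then show ?thesis by simp
qed

end

section \<open>Specialization to the continuous dual q-Hahn polynomials\<close>

theorem theorem3p7:
  fixes q \<gamma> t a b c :: complex and \<theta> :: real
  assumes "q \<noteq> 0" and "norm q < 1"
    and "t \<noteq> 0" and "a \<noteq> 0" and "b \<noteq> 0" and "c \<noteq> 0" and "norm t < 1"
    and "\<forall>m::int. t / a \<noteq> q powi m"
    and "a*b \<notin> Omega_q q" and "a*c \<notin> Omega_q q"
    and "t*b \<notin> Omega_q q" and "t*c \<notin> Omega_q q"
    and "a * cis \<theta> \<notin> Omega_q q" and "a * cis (-\<theta>) \<notin> Omega_q q"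
  shows "(\<lambda>n. qpoch \<gamma> q n * cdqH n \<theta> a b c q / (qpoch q q n * qpoch (a*b) q n * qpoch (a*c) q n) * t ^ n)
    sums
      (qpoch_inf (a * cis \<theta>) q * qpoch_inf (a * cis (-\<theta>)) q / (qpoch_inf (a*b) q * qpoch_inf (a*c) q) *
       ( qpoch_inf (a*b) q * qpoch_inf (a*c) q * qpoch_inf (\<gamma>*t/a) q
           / (qpoch_inf (a * cis \<theta>) q * qpoch_inf (a * cis (-\<theta>)) q * qpoch_inf (t/a) q)
           * phi43 \<gamma> (a * cis \<theta>) (a * cis (-\<theta>)) 0 (a*b) (a*c) (q*a/t) q q
       + qpoch_inf (t*b) q * qpoch_inf (t*c) q * qpoch_inf \<gamma> q
           / (qpoch_inf (t * cis \<theta>) q * qpoch_inf (t * cis (-\<theta>)) q * qpoch_inf (a/t) q)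
           * phi43 (\<gamma>*t/a) (t * cis \<theta>) (t * cis (-\<theta>)) 0 (t*b) (t*c) (q*t/a) q q))"
proof -
  define d e where "d = cis \<theta>" and "e = cis (-\<theta>)"
  note de = d_def[symmetric] e_def[symmetric]
  interpret q_integral q a d e
    using assms by unfold_locales (simp_all add: d_def e_def)
  have adm: "admissible t"
    unfolding admissible_def
  proof (intro conjI allI)
    fix k
    show "t * q ^ k \<noteq> a"
      using spec[OF assms(8), of "- int k"] assms(1,3,4) by (auto simp: power_int_minus field_simps)
    show "a * q ^ k \<noteq> t"
      using spec[OF assms(8), of "int k"] assms(4) by auto
  qed (use assms in auto)
  note nz = admissible_nonzero[OF adm]
  define g where "g z = qpoch_inf (z * b) q * qpoch_inf (z * c) q" for z
  have hol: "g holomorphic_on UNIV"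
    unfolding g_def[abs_def] by (intro holomorphic_on_mult entire_qpoch_inf)
  have not_Omega: "qpoch_inf x q \<noteq> 0" if "x \<notin> Omega_q q" for x
    using that unfolding qpoch_inf_eq_0_iff not_Omega_q_iff[OF assms(1)] by blast
  \<comment> \<open>Since (xy;q)_\<infinity> = (xy;q)_k (xyq^k;q)_\<infinity>, denominators such as
    (ab,ac;q)_k become values of g on the orbit; the \<open>Omega_q\<close> conditions justify the
    division.\<close>
  have split: "1 / qpoch (x * y) q k = qpoch_inf (x * q ^ k * y) q / qpoch_inf (x * y) q" if "x * y \<notin> Omega_q q" for x y k
    using not_Omega[OF that] qpoch_inf_split[of "x * y" k] by (simp add: mult_ac)
  have split2: "1 / (qpoch (x * b) q k * qpoch (x * c) q k) = g (x * q ^ k) / (qpoch_inf (x * b) q * qpoch_inf (x * c) q)"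
    if "x * b \<notin> Omega_q q" "x * c \<notin> Omega_q q" for x k
    using arg_cong2[where f = "(*)", OF split[OF that(1), of k] split[OF that(2), of k]]
    unfolding g_def times_divide_times_eq by simp
  define Pab where "Pab = qpoch_inf (a * b) q * qpoch_inf (a * c) q"
  define Ptb where "Ptb = qpoch_inf (t * b) q * qpoch_inf (t * c) q"
  have P: "Pab \<noteq> 0" "Ptb \<noteq> 0" "qpoch_inf (a * d) q \<noteq> 0" "qpoch_inf (a * e) q \<noteq> 0"
    unfolding Pab_def Ptb_def d_def e_def using not_Omega assms by simp_all
  have nzn: "qpoch (a * b) q n \<noteq> 0" "qpoch (a * c) q n \<noteq> 0" for n
    using assms(9,10) unfolding qpoch_eq_0_iff not_Omega_q_iff[OF assms(1)] by blast+
  have cdqH: "cdqH n \<theta> a b c q = qpoch q q n * qpoch (a * b) q n * qpoch (a * c) q n * (v g n / Pab)" for n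
  proof -
    define S where "S = (\<Sum>k\<le>n. qpoch (inverse (q ^ n)) q k * (qpoch (a * d) q k * qpoch (a * e) q k / qpoch q q k) * q ^ k * g (a * q ^ k))"
    have "(qpoch (inverse (q ^ n)) q k * qpoch (a * d) q k * qpoch (a * e) q k)
        / (qpoch q q k * qpoch (a*b) q k * qpoch (a*c) q k) * q ^ k
      = qpoch (inverse (q ^ n)) q k * (qpoch (a * d) q k * qpoch (a * e) q k / qpoch q q k) * q ^ k
          * (1 / (qpoch (a*b) q k * qpoch (a*c) q k))" for k
      by (simp add: mult.assoc)
    then have "(\<Sum>k=0..n. (qpoch (inverse (q ^ n)) q k * qpoch (a * d) q k * qpoch (a * e) q k)
        / (qpoch q q k * qpoch (a*b) q k * qpoch (a*c) q k) * q ^ k) = S / Pab"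
      unfolding split2[OF assms(9,10)] S_def Pab_def sum_divide_distrib by (simp add: atMost_atLeast0)
    then have "cdqH n \<theta> a b c q = inverse (a ^ n) * qpoch (a*b) q n * qpoch (a*c) q n * (S / Pab)"
      unfolding cdqH_def de by simp
    moreover have "v g n = inverse (a ^ n) / qpoch q q n * S"
      unfolding v_def S_def ..
    ultimately show ?thesis by simp
  qed
  have lhs: "qpoch \<gamma> q n * cdqH n \<theta> a b c q / (qpoch q q n * qpoch (a*b) q n * qpoch (a*c) q n) * t ^ n
      = qpoch \<gamma> q n * (v g n * t ^ n) / Pab" for n
    unfolding cdqH using nzn[of n] by simp
  define A where "A = (\<Sum>k. qpoch \<gamma> q k * (weight_a t k * g (a * q ^ k)))"
  define T where "T = (\<Sum>k. qpoch (\<gamma> * (t / a)) q k * (weight_t t k * g (t * q ^ k)))"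
  define C where "C = qpoch_inf (a * d) q * qpoch_inf (a * e) q / (qpoch_inf (t * d) q * qpoch_inf (t * e) q * qpoch_inf (a / t) q)"
  have C: "C \<noteq> 0"
    unfolding C_def using P nz(7-9) by simp
  \<comment> \<open>One formula serves both series, with (x, y) = (a, t) and with (x, y) = (t,
    a).\<close>
  have phi_term: "(qpoch z q k * qpoch (x * d) q k * qpoch (x * e) q k * qpoch 0 q k) /
        (qpoch q q k * qpoch (x*b) q k * qpoch (x*c) q k * qpoch (q*x/y) q k) * q ^ k
      = qpoch z q k * (W x y k * q ^ k * g (x * q ^ k)) / (qpoch_inf (x * b) q * qpoch_inf (x * c) q)"
    if "x * b \<notin> Omega_q q" "x * c \<notin> Omega_q q" for x y z k
  proof -
    have "(qpoch z q k * qpoch (x * d) q k * qpoch (x * e) q k * qpoch 0 q k) /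
        (qpoch q q k * qpoch (x*b) q k * qpoch (x*c) q k * qpoch (q*x/y) q k) * q ^ k
      = qpoch z q k * (W x y k * q ^ k) * (1 / (qpoch (x * b) q k * qpoch (x * c) q k))"
      unfolding W_def by (simp add: mult_ac)
    then show ?thesis
      unfolding split2[OF that] by (simp add: mult.assoc)
  qed
  have cont: "isCont g 0"
    using holomorphic_on_imp_continuous_on[OF hol] by (simp add: continuous_on_eq_continuous_at)
  have sum_A: "summable (\<lambda>k. qpoch \<gamma> q k * (weight_a t k * g (a * q ^ k)))"
    and sum_T: "summable (\<lambda>k. qpoch (\<gamma> * (t / a)) q k * (weight_t t k * g (t * q ^ k)))"
    by (intro summable_qpoch_times summable_weights adm convergent_along_powers cont)+
  have weights: "W a t k * q ^ k = qpoch_inf (t / a) q * weight_a t k" "W t a k * q ^ k = weight_t t k / C" for k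
    unfolding weight_a_def weight_t_def C_def[symmetric] using nz(6) C by simp_all
  have phi_a: "phi43 \<gamma> (a * d) (a * e) 0 (a*b) (a*c) (q*a/t) q q = qpoch_inf (t / a) q / Pab * A"
    unfolding phi43_def phi_term[OF assms(9,10)] weights A_def suminf_mult[OF sum_A, symmetric] Pab_def
    by (simp add: mult_ac)
  have phi_t: "phi43 (\<gamma>*t/a) (t * d) (t * e) 0 (t*b) (t*c) (q*t/a) q q = 1 / (C * Ptb) * T"
    unfolding phi43_def phi_term[OF assms(11,12)] weights T_def suminf_mult[OF sum_T, symmetric] Ptb_def
    by (simp add: mult_ac)
  have "(\<lambda>n. qpoch \<gamma> q n * (v g n * t ^ n) / Pab) sums (GenQ g \<gamma> t / Pab)"
    unfolding GenQ_def
    by (intro sums_divide summable_sums summable_qpoch_times summable_v_entire hol assms(7))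
  also have "GenQ g \<gamma> t = qpoch_inf (\<gamma> * t / a) q * A + qpoch_inf \<gamma> q * T"
    unfolding GenQ_eq_JQ[OF hol adm] JQ_def A_def T_def by simp
  \<comment> \<open>The outer factor (ad,ae;q)_\<infinity> cancels in the first term, while with the
    prefactor of the second it forms exactly C.\<close>
  also have "\<dots> / Pab = qpoch_inf (a * d) q * qpoch_inf (a * e) q / Pab *
       (Pab * qpoch_inf (\<gamma>*t/a) q / (qpoch_inf (a * d) q * qpoch_inf (a * e) q * qpoch_inf (t/a) q)
           * (qpoch_inf (t / a) q / Pab * A)
       + Ptb * qpoch_inf \<gamma> q / (qpoch_inf (t * d) q * qpoch_inf (t * e) q * qpoch_inf (a/t) q)
           * (1 / (C * Ptb) * T))"
    unfolding C_def using P nz(6-9) by (simp add: distrib_left add_divide_distrib)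
  finally show ?thesis
    unfolding lhs phi_a[symmetric] phi_t[symmetric] unfolding Pab_def Ptb_def de .
qed

end
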